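(* Let $\mathcal{A}$ be a unital complex algebra, $\varphi:\mathcal{A}\to\mathbb{C}$ a unital linear functional, and $(\mathcal{A}_i)_{i\in I}$ (not necessarily unital) subalgebras of $\mathcal{A}$ that are Boolean independent relatively to $\varphi$. Then the subalgebras $\bar T(\mathcal{A}_i)$, $i\in I$, of $T(\mathcal{A})$ are cyclically Boolean independent relatively to $(\varphi,[\varphi])$.
   Context: Tensor algebra: $T(\mathcal{A})=\mathbb{C}1\oplus\bigoplus_{n\ge1}\mathcal{A}^{\otimes n}$ with product $\otimes$; $\bar T(\mathcal{A}_i)=\bigoplus_{n\ge1}\mathcal{A}_i^{\otimes n}$. The functional $\varphi$ is extended to $T(\mathcal{A})$ by $\varphi(a_1\otimes\cdots\otimes a_n)=\varphi(a_1\cdots a_n)$, $\varphi(1)=1$. Boolean independence of subalgebras $(\mathcal{B}_i)_{i\in I}$ with respect to $\varphi$: $\varphi(a_1\cdots a_n)=\varphi(a_1)\cdots\varphi(a_n)$ whenever $a_k\in\mathcal{B}_{j_k}$ and $j_k\ne j_{k+1}$ for $1\le k\le n-1$. Cyclic Boolean independence of subalgebras $(\mathcal{B}_i)_{i\in I}$ relatively to $(\varphi,\omega)$, $\omega$ being a tracial linear functional: the $\mathcal{B}_i$ are Boolean independent with respect to $\varphi$ and $\omega(a_1\cdots a_n)=\varphi(a_1\cdots a_n)$ for all $n\ge2$ and $a_k\in\mathcal{B}_{j_k}$ with $j_k\neq j_{k+1}$ for $1\le k\le n-1$ and $j_n\ne j_1$. Boolean cumulants $\beta^\varphi$ are defined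 recursively by $\varphi(a_1\cdots a_n)=\sum_{I}\prod_{\{i,\ldots,j\}\in I}\beta^\varphi(a_i,\ldots,a_j)$, the sum over interval partitions $I$ of $\{1,\ldots,n\}$. The functional $[\varphi]$ on $T(\mathcal{A})$ is defined by $[\varphi](1)=1$ and $$[\varphi](a_1\otimes\cdots\otimes a_n)=\sum_{\ell=1}^n\ \sum_{1\le i_1<\cdots<i_\ell\le n}\ \prod_{k=1}^{\ell}\beta^\varphi(a_{i_k},a_{i_k+1},\ldots,a_{i_{k+1}-1}),$$ with $i_{\ell+1}=i_1$ and indices read cyclically modulo $n$ (the last factor is $\beta^\varphi(a_{i_\ell},\ldots,a_n,a_1,\ldots,a_{i_1-1})$). *)

theory Defs
  imports Complex_Main "HOL-Library.Poly_Mapping" "HOL-Library.Disjoint_Sets"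
begin

section \<open>Unital complex algebras\<close>

text \<open>The axiom \<^term>\<open>0 \<noteq> 1\<close> inherited from \<^class>\<open>ring_1\<close> costs no generality
  here: an algebra with a unital linear functional is nonzero.\<close>

class complex_algebra_1 = ring_1 +
  fixes scaleC :: "complex \<Rightarrow> 'a \<Rightarrow> 'a" (infixr "*\<^sub>C" 75)
  assumes scaleC_add_right: "c *\<^sub>C (x + y) = c *\<^sub>C x + c *\<^sub>C y"
    and scaleC_add_left: "(c + d) *\<^sub>C x = c *\<^sub>C x + d *\<^sub>C x"
    and scaleC_scaleC: "c *\<^sub>C (d *\<^sub>C x) = (c * d) *\<^sub>C x"
    and scaleC_one: "1 *\<^sub>C x = x"
    and mult_scaleC_left: "(c *\<^sub>C x) * y = c *\<^sub>C (x * y)"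
    and mult_scaleC_right: "x * (c *\<^sub>C y) = c *\<^sub>C (x * y)"

lemma vector_space_scaleC:
  "vector_space (scaleC :: complex \<Rightarrow> 'a::complex_algebra_1 \<Rightarrow> 'a)"
  by unfold_locales (simp_all add: scaleC_add_right scaleC_add_left scaleC_scaleC scaleC_one)

definition linear_functional :: "('a::complex_algebra_1 \<Rightarrow> complex) \<Rightarrow> bool" where
  "linear_functional f \<longleftrightarrow> Vector_Spaces.linear (*\<^sub>C) (*) f"

lemma linear_functional_iff:
  "linear_functional f \<longleftrightarrow> (\<forall>x y. f (x + y) = f x + f y) \<and> (\<forall>c x. f (c *\<^sub>C x) = c * f x)"
proof -
  have "vector_space ((*) :: complex \<Rightarrow> complex \<Rightarrow> complex)"
    by unfold_locales (simp_all add: algebra_simps)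
  then show ?thesis
    by (auto simp: linear_functional_def Vector_Spaces.linear_iff vector_space_scaleC)
qed

definition tracial :: "('a::complex_algebra_1 \<Rightarrow> complex) \<Rightarrow> bool" where
  "tracial f \<longleftrightarrow> (\<forall>x y. f (x * y) = f (y * x))"

text \<open>Subalgebras need not contain the unit.\<close>

definition subalgebra :: "'a::complex_algebra_1 set \<Rightarrow> bool" where
  "subalgebra B \<longleftrightarrow> module.subspace (*\<^sub>C) B \<and> (\<forall>x\<in>B. \<forall>y\<in>B. x * y \<in> B)"


section \<open>Boolean and cyclic Boolean independence\<close>

text \<open>Sequences \<open>a\<^sub>1, \<dots>, a\<^sub>n\<close> and \<open>j\<^sub>1, \<dots>, j\<^sub>n\<close> are indexed from \<open>0\<close>.\<close>

definition boolean_independent ::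
    "('a::complex_algebra_1 \<Rightarrow> complex) \<Rightarrow> 'i set \<Rightarrow> ('i \<Rightarrow> 'a set) \<Rightarrow> bool" where
  "boolean_independent \<phi> I B \<longleftrightarrow>
     (\<forall>i\<in>I. subalgebra (B i)) \<and>
     (\<forall>n a j. 1 \<le> n \<longrightarrow> (\<forall>k<n. j k \<in> I \<and> a k \<in> B (j k)) \<longrightarrow>
        (\<forall>k. Suc k < n \<longrightarrow> j k \<noteq> j (Suc k)) \<longrightarrow>
        \<phi> (\<Prod>k\<leftarrow>[0..<n]. a k) = (\<Prod>k<n. \<phi> (a k)))"

definition cyclic_boolean_independent ::
    "('a::complex_algebra_1 \<Rightarrow> complex) \<Rightarrow> ('a \<Rightarrow> complex) \<Rightarrow> 'i set \<Rightarrow> ('i \<Rightarrow> 'a set) \<Rightarrow> bool" where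
  "cyclic_boolean_independent \<phi> \<omega> I B \<longleftrightarrow>
     linear_functional \<omega> \<and> tracial \<omega> \<and> boolean_independent \<phi> I B \<and>
     (\<forall>n a j. 2 \<le> n \<longrightarrow> (\<forall>k<n. j k \<in> I \<and> a k \<in> B (j k)) \<longrightarrow>
        (\<forall>k. Suc k < n \<longrightarrow> j k \<noteq> j (Suc k)) \<longrightarrow> j (n - 1) \<noteq> j 0 \<longrightarrow>
        \<omega> (\<Prod>k\<leftarrow>[0..<n]. a k) = \<phi> (\<Prod>k\<leftarrow>[0..<n]. a k))"


section \<open>The tensor algebra\<close>

text \<open>The complex vector space with basis the lists over \<^typ>\<open>'a\<close>, with product extending
  concatenation of lists, is a ring by the library instances for
  \<^type>\<open>poly_mapping\<close>, which write the monoid of exponents additively.\<close>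

instantiation list :: (type) monoid_add
begin

definition plus_list :: "'a list \<Rightarrow> 'a list \<Rightarrow> 'a list" where
  "plus_list xs ys = xs @ ys"

definition zero_list :: "'a list" where
  "zero_list = []"

instance
  by standard (simp_all add: plus_list_def zero_list_def)

end

text \<open>The tensor algebra is the quotient of this space by the multilinearity relations.
  The relations preserve the length of lists, so the quotient is the direct sum over \<open>n \<ge> 0\<close> of
  the \<open>n\<close>-th tensor powers over \<open>\<complex>\<close>; the list \<open>[a\<^sub>1, \<dots>, a\<^sub>n]\<close> represents
  \<open>a\<^sub>1 \<otimes> \<dots> \<otimes> a\<^sub>n\<close> and the empty list represents \<open>1\<close>.\<close>

inductive_set tensor_relations :: "('a::complex_algebra_1 list \<Rightarrow>\<^sub>0 complex) set" where
  zero: "0 \<in> tensor_relations"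
| add: "p \<in> tensor_relations \<Longrightarrow> q \<in> tensor_relations \<Longrightarrow> p + q \<in> tensor_relations"
| additive: "Poly_Mapping.single (xs @ [a + b] @ ys) c
    - Poly_Mapping.single (xs @ [a] @ ys) c
    - Poly_Mapping.single (xs @ [b] @ ys) c \<in> tensor_relations"
| homogeneous: "Poly_Mapping.single (xs @ [r *\<^sub>C a] @ ys) c
    - Poly_Mapping.single (xs @ [a] @ ys) (r * c) \<in> tensor_relations"

lemma tensor_relations_mult_single_left:
  "p \<in> tensor_relations \<Longrightarrow> Poly_Mapping.single zs e * p \<in> tensor_relations"
proof (induction rule: tensor_relations.induct)
  case (additive xs a b ys c)
  show ?case
    using tensor_relations.additive[of "zs @ xs" a b ys "e * c"]
    by (simp add: right_diff_distrib mult_single plus_list_def)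
next
  case (homogeneous xs r a ys c)
  show ?case
    using tensor_relations.homogeneous[of "zs @ xs" r a ys "e * c"]
    by (simp add: right_diff_distrib mult_single plus_list_def mult.left_commute)
qed (simp_all add: distrib_left tensor_relations.intros)

lemma tensor_relations_mult_single_right:
  "p \<in> tensor_relations \<Longrightarrow> p * Poly_Mapping.single zs e \<in> tensor_relations"
proof (induction rule: tensor_relations.induct)
  case (additive xs a b ys c)
  show ?case
    using tensor_relations.additive[of xs a b "ys @ zs" "c * e"]
    by (simp add: left_diff_distrib mult_single plus_list_def)
next
  case (homogeneous xs r a ys c)
  show ?case
    using tensor_relations.homogeneous[of xs r a "ys @ zs" "c * e"]
    by (simp add: left_diff_distrib mult_single plus_list_def mult.assoc)
qed (simp_all add: distrib_right tensor_relations.intros)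

lemma free_algebra_induct [case_names zero single add]:
  fixes p :: "'b \<Rightarrow>\<^sub>0 complex"
  assumes zero: "P 0" and single: "\<And>xs c. P (Poly_Mapping.single xs c)"
    and add: "\<And>p q. P p \<Longrightarrow> P q \<Longrightarrow> P (p + q)"
  shows "P p"
proof (induction p rule: update_induct)
  case const
  show ?case by (rule zero)
next
  case (update f a b)
  have "Poly_Mapping.update a b f = f + Poly_Mapping.single a b"
    using update(1)
    by (intro poly_mapping_eqI) (auto simp: lookup_update lookup_add lookup_single when_def in_keys_iff)
  then show ?case using add[OF update(3) single] by simp
qed

lemma tensor_relations_mult_left: "p \<in> tensor_relations \<Longrightarrow> q * p \<in> tensor_relations"
  by (induction q rule: free_algebra_induct)
    (simp_all add: distrib_right tensor_relations.intros tensor_relations_mult_single_left)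

lemma tensor_relations_mult_right: "p \<in> tensor_relations \<Longrightarrow> p * q \<in> tensor_relations"
  by (induction q rule: free_algebra_induct)
    (simp_all add: distrib_left tensor_relations.intros tensor_relations_mult_single_right)

lemma tensor_relations_uminus: "p \<in> tensor_relations \<Longrightarrow> - p \<in> tensor_relations"
  using tensor_relations_mult_left[of p "- 1"] by simp

lemma tensor_relations_diff:
  "p \<in> tensor_relations \<Longrightarrow> q \<in> tensor_relations \<Longrightarrow> p - q \<in> tensor_relations"
  using tensor_relations.add[OF _ tensor_relations_uminus, of p q] by simp

lemma one_notin_tensor_relations: "1 \<notin> tensor_relations"
proof -
  have "p \<in> tensor_relations \<Longrightarrow> Poly_Mapping.lookup p [] = 0" for p :: "'a list \<Rightarrow>\<^sub>0 complex"
    by (induction rule: tensor_relations.induct)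
      (simp_all add: lookup_add lookup_minus lookup_single)
  moreover have "Poly_Mapping.lookup (1 :: 'a list \<Rightarrow>\<^sub>0 complex) [] = 1"
    using lookup_one[of "[] :: 'a list"] by (simp add: zero_list_def)
  ultimately show ?thesis by fastforce
qed

definition tensor_eq ::
    "('a::complex_algebra_1 list \<Rightarrow>\<^sub>0 complex) \<Rightarrow> ('a list \<Rightarrow>\<^sub>0 complex) \<Rightarrow> bool" where
  "tensor_eq p q \<longleftrightarrow> p - q \<in> tensor_relations"

quotient_type (overloaded) 'a tensor_algebra =
  "'a::complex_algebra_1 list \<Rightarrow>\<^sub>0 complex" / tensor_eq
proof (rule equivpI)
  show "reflp tensor_eq"
    by (simp add: reflp_def tensor_eq_def tensor_relations.zero)
  show "symp tensor_eq"
    unfolding symp_def tensor_eq_def using tensor_relations_uminus by fastforce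
  show "transp tensor_eq"
    unfolding transp_def tensor_eq_def using tensor_relations.add by fastforce
qed

instantiation tensor_algebra :: (complex_algebra_1) complex_algebra_1
begin

lift_definition zero_tensor_algebra :: "'a tensor_algebra" is 0 .

lift_definition one_tensor_algebra :: "'a tensor_algebra" is 1 .

lift_definition plus_tensor_algebra ::
  "'a tensor_algebra \<Rightarrow> 'a tensor_algebra \<Rightarrow> 'a tensor_algebra" is "(+)"
  unfolding tensor_eq_def using tensor_relations.add by (fastforce simp: algebra_simps)

lift_definition uminus_tensor_algebra :: "'a tensor_algebra \<Rightarrow> 'a tensor_algebra" is uminus
  unfolding tensor_eq_def using tensor_relations_uminus by fastforce

lift_definition minus_tensor_algebra ::
  "'a tensor_algebra \<Rightarrow> 'a tensor_algebra \<Rightarrow> 'a tensor_algebra" is "(-)"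
  unfolding tensor_eq_def using tensor_relations_diff by (fastforce simp: algebra_simps)

lift_definition times_tensor_algebra ::
  "'a tensor_algebra \<Rightarrow> 'a tensor_algebra \<Rightarrow> 'a tensor_algebra" is "(*)"
proof -
  fix p p' q q' :: "'a list \<Rightarrow>\<^sub>0 complex"
  assume "tensor_eq p p'" "tensor_eq q q'"
  then have "(p - p') * q + p' * (q - q') \<in> tensor_relations"
    unfolding tensor_eq_def
    by (intro tensor_relations.add tensor_relations_mult_left tensor_relations_mult_right)
  then show "tensor_eq (p * q) (p' * q')"
    by (simp add: tensor_eq_def algebra_simps)
qed

lift_definition scaleC_tensor_algebra ::
  "complex \<Rightarrow> 'a tensor_algebra \<Rightarrow> 'a tensor_algebra" is "\<lambda>c p. Poly_Mapping.single [] c * p"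
  unfolding tensor_eq_def by (simp add: tensor_relations_mult_left flip: right_diff_distrib)

instance
proof
  have rel: "tensor_eq p p" for p :: "'a list \<Rightarrow>\<^sub>0 complex"
    by (simp add: tensor_eq_def tensor_relations.zero)
  have comm: "p * Poly_Mapping.single [] c = Poly_Mapping.single [] c * p"
    for p :: "'a list \<Rightarrow>\<^sub>0 complex" and c
    by (induction p rule: free_algebra_induct)
      (simp_all add: algebra_simps mult_single plus_list_def)
  fix x y z :: "'a tensor_algebra" and c d :: complex
  show "x + y + z = x + (y + z)"
    by transfer (simp add: add.assoc rel)
  show "x + y = y + x"
    by transfer (simp add: add.commute rel)
  show "0 + x = x"
    by transfer (simp add: rel)
  show "- x + x = 0"
    by transfer (simp add: rel)
  show "x - y = x + - y"
    by transfer (simp add: rel)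
  show "x * y * z = x * (y * z)"
    by transfer (simp add: mult.assoc rel)
  show "(x + y) * z = x * z + y * z"
    by transfer (simp add: distrib_right rel)
  show "x * (y + z) = x * y + x * z"
    by transfer (simp add: distrib_left rel)
  show "1 * x = x"
    by transfer (simp add: rel)
  show "x * 1 = x"
    by transfer (simp add: rel)
  show "(0 :: 'a tensor_algebra) \<noteq> 1"
  proof (transfer, rule notI)
    assume "tensor_eq (0 :: 'a list \<Rightarrow>\<^sub>0 complex) 1"
    then have "(- 1 :: 'a list \<Rightarrow>\<^sub>0 complex) \<in> tensor_relations" by (simp add: tensor_eq_def)
    then show False using tensor_relations_uminus one_notin_tensor_relations by fastforce
  qed
  show "c *\<^sub>C (x + y) = c *\<^sub>C x + c *\<^sub>C y"
    by transfer (simp add: distrib_left rel)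
  show "(c + d) *\<^sub>C x = c *\<^sub>C x + d *\<^sub>C x"
    by transfer (simp add: distrib_right single_add rel)
  show "c *\<^sub>C (d *\<^sub>C x) = (c * d) *\<^sub>C x"
    by transfer (simp add: mult_single plus_list_def rel flip: mult.assoc)
  show "1 *\<^sub>C x = x"
    by transfer (use single_one[where ?'a = "'a list" and ?'b = complex] in
      \<open>simp add: zero_list_def rel\<close>)
  show "(c *\<^sub>C x) * y = c *\<^sub>C (x * y)"
    by transfer (simp add: mult.assoc rel)
  show "x * (c *\<^sub>C y) = c *\<^sub>C (x * y)"
    by transfer (simp add: comm rel flip: mult.assoc)
qed

end

text \<open>\<open>tensor [a\<^sub>1, \<dots>, a\<^sub>n]\<close> is \<open>a\<^sub>1 \<otimes> \<dots> \<otimes> a\<^sub>n\<close>.\<close>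

lift_definition tensor :: "'a::complex_algebra_1 list \<Rightarrow> 'a tensor_algebra"
  is "\<lambda>xs. Poly_Mapping.single xs 1" .

lemma tensor_Nil: "tensor [] = 1"
  by transfer (use single_one[where ?'a = "'a list" and ?'b = complex] in
    \<open>simp add: zero_list_def tensor_eq_def tensor_relations.zero\<close>)

lemma tensor_append: "tensor (xs @ ys) = tensor xs * tensor ys"
  by transfer (simp add: mult_single plus_list_def tensor_eq_def tensor_relations.zero)

lemma tensor_add: "tensor (xs @ [a + b] @ ys) = tensor (xs @ [a] @ ys) + tensor (xs @ [b] @ ys)"
  by transfer (use tensor_relations.additive in \<open>fastforce simp: tensor_eq_def algebra_simps\<close>)

lemma tensor_scaleC: "tensor (xs @ [r *\<^sub>C a] @ ys) = r *\<^sub>C tensor (xs @ [a] @ ys)"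
  by transfer
    (use tensor_relations.homogeneous[where c = 1] in
      \<open>fastforce simp: tensor_eq_def mult_single plus_list_def\<close>)

lemma tensor_algebra_induct [case_names zero tensor add]:
  assumes zero: "P 0" and tensor: "\<And>c xs. P (c *\<^sub>C tensor xs)"
    and add: "\<And>t u. P t \<Longrightarrow> P u \<Longrightarrow> P (t + u)"
  shows "P t"
proof (induction t rule: tensor_algebra.abs_induct)
  fix p :: "'a list \<Rightarrow>\<^sub>0 complex"
  show "P (abs_tensor_algebra p)"
  proof (induction p rule: free_algebra_induct)
    case zero
    show ?case using assms(1) by (simp add: zero_tensor_algebra_def)
  next
    case (single xs c)
    show ?case using tensor[of c xs]
      by (simp add: tensor.abs_eq scaleC_tensor_algebra.abs_eq mult_single plus_list_def)
  next
    case (add p q)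
    then show ?case using assms(3) by (simp flip: plus_tensor_algebra.abs_eq)
  qed
qed

definition reduced_tensor_algebra :: "'a::complex_algebra_1 set \<Rightarrow> 'a tensor_algebra set" where
  "reduced_tensor_algebra B = module.span (*\<^sub>C) {tensor xs | xs. xs \<noteq> [] \<and> set xs \<subseteq> B}"


section \<open>Linear functionals on the tensor algebra\<close>

text \<open>For multilinear \<open>f\<close>, the linear functional with
  \<open>a\<^sub>1 \<otimes> \<dots> \<otimes> a\<^sub>n \<mapsto> f [a\<^sub>1, \<dots>, a\<^sub>n]\<close> for all \<open>n \<ge> 0\<close>.\<close>

definition tensor_functional ::
    "('a::complex_algebra_1 list \<Rightarrow> complex) \<Rightarrow> 'a tensor_algebra \<Rightarrow> complex" where
  "tensor_functional f = (THE F. linear_functional F \<and> (\<forall>xs. F (tensor xs) = f xs))"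

definition multilinear :: "('a::complex_algebra_1 list \<Rightarrow> complex) \<Rightarrow> bool" where
  "multilinear f \<longleftrightarrow>
     (\<forall>xs a b ys. f (xs @ [a + b] @ ys) = f (xs @ [a] @ ys) + f (xs @ [b] @ ys)) \<and>
     (\<forall>xs r a ys. f (xs @ [r *\<^sub>C a] @ ys) = r * f (xs @ [a] @ ys))"

lemma linear_functional_tensor_unique:
  assumes F: "linear_functional F" and G: "linear_functional G"
    and eq: "\<And>xs. F (tensor xs) = G (tensor xs)"
  shows "F = G"
proof
  fix t show "F t = G t"
  proof (induction t rule: tensor_algebra_induct)
    case zero
    have "F (0 *\<^sub>C 0) = 0" "G (0 *\<^sub>C 0) = 0"
      using F G by (simp_all only: linear_functional_iff mult_zero_left)
    moreover have "(0 :: complex) *\<^sub>C (0 :: 'a tensor_algebra) = 0"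
      using scaleC_add_left[of 0 0 "0 :: 'a tensor_algebra"] by simp
    ultimately show ?case by simp
  qed (use F G eq in \<open>simp_all add: linear_functional_iff\<close>)
qed

lemma tensor_functional_exists:
  assumes f: "multilinear f"
  shows "\<exists>F. linear_functional F \<and> (\<forall>xs. F (tensor xs) = f xs)"
proof -
  define L where "L p = Sum_any (\<lambda>xs. Poly_Mapping.lookup p xs * f xs)" for p
  have fin: "finite {xs. Poly_Mapping.lookup p xs * f xs \<noteq> 0}" for p
    by (rule finite_subset[OF _ finite_keys[of p]]) (auto simp: in_keys_iff)
  have L_add: "L (p + q) = L p + L q" for p q
    unfolding L_def lookup_add distrib_right by (rule Sum_any.distrib) (rule fin)+
  have L_single: "L (Poly_Mapping.single xs c) = c * f xs" for xs c
  proof -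
    have "L (Poly_Mapping.single xs c) = Sum_any (\<lambda>ys. (c * f xs) when ys = xs)"
      unfolding L_def by (rule Sum_any.cong) (auto simp: lookup_single when_def)
    then show ?thesis by simp
  qed
  have L_diff: "L (p - q) = L p - L q" for p q
    using L_add[of "p - q" q] by simp
  have L_zero: "L 0 = 0" by (simp add: L_def)
  have L_rel: "L p = 0" if "p \<in> tensor_relations" for p
    using that
  proof (induction rule: tensor_relations.induct)
    case (additive xs a b ys c)
    have "f (xs @ [a + b] @ ys) = f (xs @ [a] @ ys) + f (xs @ [b] @ ys)"
      using f by (simp only: multilinear_def)
    then show ?case by (simp only: L_diff L_single) (simp add: algebra_simps)
  next
    case (homogeneous xs r a ys c)
    have "f (xs @ [r *\<^sub>C a] @ ys) = r * f (xs @ [a] @ ys)"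
      using f by (simp only: multilinear_def)
    then show ?case by (simp only: L_diff L_single) (simp add: algebra_simps)
  qed (simp_all add: L_zero L_add)
  have L_scale: "L (Poly_Mapping.single [] c * p) = c * L p" for c p
    by (induction p rule: free_algebra_induct)
      (simp_all add: L_zero L_add L_single mult_single plus_list_def distrib_left mult.assoc)
  define F where "F t = L (rep_tensor_algebra t)" for t
  have F_abs: "F (abs_tensor_algebra p) = L p" for p
  proof -
    have "tensor_eq (rep_tensor_algebra (abs_tensor_algebra p)) p"
      by (rule Quotient3_rep_abs[OF Quotient3_tensor_algebra])
        (simp add: tensor_eq_def tensor_relations.zero)
    then show ?thesis
      using L_rel L_diff unfolding F_def tensor_eq_def by (metis eq_iff_diff_eq_0)
  qed
  have "linear_functional F"
    unfolding linear_functional_iff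
  proof (intro conjI allI)
    fix t u :: "'a tensor_algebra" and c
    show "F (t + u) = F t + F u"
      by (induction t rule: tensor_algebra.abs_induct, induction u rule: tensor_algebra.abs_induct)
        (simp add: plus_tensor_algebra.abs_eq F_abs L_add)
    show "F (c *\<^sub>C t) = c * F t"
      by (induction t rule: tensor_algebra.abs_induct)
        (simp add: scaleC_tensor_algebra.abs_eq F_abs L_scale)
  qed
  moreover have "F (tensor xs) = f xs" for xs
    by (simp add: tensor.abs_eq F_abs L_single)
  ultimately show ?thesis by blast
qed

lemma tensor_functional:
  assumes "multilinear f"
  shows linear_tensor_functional: "linear_functional (tensor_functional f)"
    and tensor_functional_tensor: "tensor_functional f (tensor xs) = f xs"
proof -
  have "\<exists>!F. linear_functional F \<and> (\<forall>xs. F (tensor xs) = f xs)"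
    using tensor_functional_exists[OF assms] linear_functional_tensor_unique by metis
  from theI'[OF this]
  show "linear_functional (tensor_functional f)" "tensor_functional f (tensor xs) = f xs"
    unfolding tensor_functional_def by blast+
qed

text \<open>For unital \<open>\<phi>\<close>, the empty product gives the value \<open>1\<close> at the unit of the tensor algebra.\<close>

definition extended_functional ::
    "('a::complex_algebra_1 \<Rightarrow> complex) \<Rightarrow> 'a tensor_algebra \<Rightarrow> complex" where
  "extended_functional \<phi> = tensor_functional (\<lambda>xs. \<phi> (prod_list xs))"

lemma extended_functional:
  assumes "linear_functional \<phi>"
  shows linear_extended_functional: "linear_functional (extended_functional \<phi>)"
    and extended_functional_tensor: "extended_functional \<phi> (tensor xs) = \<phi> (prod_list xs)"
proof -
  have "multilinear (\<lambda>xs. \<phi> (prod_list xs))"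
    using assms unfolding multilinear_def linear_functional_iff
    by (simp add: distrib_left distrib_right mult_scaleC_left mult_scaleC_right)
  then show "linear_functional (extended_functional \<phi>)"
    "extended_functional \<phi> (tensor xs) = \<phi> (prod_list xs)"
    unfolding extended_functional_def by (rule tensor_functional)+
qed


section \<open>Boolean cumulants\<close>

definition interval_partitions :: "nat \<Rightarrow> nat set set set" where
  "interval_partitions n = {P. partition_on {..<n} P \<and> (\<forall>B\<in>P. \<exists>i j. B = {i..j})}"

lemma interval_partition_block:
  assumes "P \<in> interval_partitions n - {{{..<n}}}" "B \<in> P"
  shows "B \<subset> {..<n}"
proof -
  have P: "partition_on {..<n} P" and ne: "P \<noteq> {{..<n}}"
    using assms(1) by (auto simp: interval_partitions_def)
  have "P = {{..<n}}" if "B = {..<n}"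
  proof -
    have "C = B" if "C \<in> P" for C
    proof (rule ccontr)
      assume "C \<noteq> B"
      then have "C \<inter> B = {}"
        using P that assms(2) by (auto simp: partition_on_def disjoint_def)
      moreover have "C \<subseteq> {..<n}" "C \<noteq> {}"
        using P that by (auto simp: partition_on_def)
      ultimately show False using \<open>B = {..<n}\<close> by blast
    qed
    then show ?thesis using assms(2) \<open>B = {..<n}\<close> by blast
  qed
  moreover have "B \<subseteq> {..<n}"
    using P assms(2) by (auto simp: partition_on_def)
  ultimately show ?thesis using ne by blast
qed

text \<open>The moment-cumulant formula solved for the term of the one-block partition;
  \<open>nths xs B\<close> is the sublist of \<open>xs\<close> at the positions in the block \<open>B\<close>.\<close>

function boolean_cumulant :: "('a::complex_algebra_1 \<Rightarrow> complex) \<Rightarrow> 'a list \<Rightarrow> complex" where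
  "boolean_cumulant \<phi> xs = \<phi> (prod_list xs)
     - (\<Sum>P \<in> interval_partitions (length xs) - {{{..<length xs}}}.
          \<Prod>B\<in>P. boolean_cumulant \<phi> (nths xs B))"
  by auto
termination
proof (relation "measure (\<lambda>(\<phi>, xs). length xs)")
  fix \<phi> :: "'a \<Rightarrow> complex" and xs :: "'a list" and P B
  assume "P \<in> interval_partitions (length xs) - {{{..<length xs}}}" "B \<in> P"
  then have "B \<subset> {..<length xs}" by (rule interval_partition_block)
  moreover from this have "{i. i < length xs \<and> i \<in> B} = B" by auto
  ultimately have "length (nths xs B) < length xs"
    using psubset_card_mono[of "{..<length xs}" B] by (simp add: length_nths)
  then show "((\<phi>, nths xs B), (\<phi>, xs)) \<in> measure (\<lambda>(\<phi>, xs). length xs)" by simp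
qed simp

declare boolean_cumulant.simps [simp del]

lemma moment_boolean_cumulant:
  assumes "xs \<noteq> []"
  shows "\<phi> (prod_list xs) =
    (\<Sum>P \<in> interval_partitions (length xs). \<Prod>B\<in>P. boolean_cumulant \<phi> (nths xs B))"
proof -
  let ?n = "length xs"
  have "interval_partitions ?n \<subseteq> Pow (Pow {..<?n})"
    by (auto simp: interval_partitions_def partition_on_def)
  then have fin: "finite (interval_partitions ?n)"
    by (rule finite_subset) simp
  have "{..<?n} = {0..?n - 1}" using assms by (cases xs) auto
  then have mem: "{{..<?n}} \<in> interval_partitions ?n"
    using assms by (auto simp: interval_partitions_def partition_on_def)
  show ?thesis
    by (simp add: sum.remove[OF fin mem] boolean_cumulant.simps[of \<phi> xs])
qed


section \<open>The functional \<open>[\<phi>]\<close>\<close>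

text \<open>Positions are counted from \<open>0\<close>. A list \<open>is\<close> stands for \<open>i\<^sub>1 < \<dots> < i\<^sub>\<ell>\<close>; appending
  \<open>hd is + n\<close> and reading positions modulo \<open>n\<close> implements \<open>i\<^sub>\<ell>\<^sub>+\<^sub>1 = i\<^sub>1\<close> with cyclic indices, so
  that for \<open>\<ell> = 1\<close> the only factor has \<open>n\<close> arguments.\<close>

definition cyclic_boolean_moment ::
    "('a::complex_algebra_1 \<Rightarrow> complex) \<Rightarrow> 'a list \<Rightarrow> complex" where
  "cyclic_boolean_moment \<phi> xs =
     (let n = length xs in
      if n = 0 then 1
      else \<Sum>l = 1..n. \<Sum>is \<in> {is. length is = l \<and> sorted_wrt (<) is \<and> set is \<subseteq> {..<n}}.
        \<Prod>k<l. boolean_cumulant \<phi>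
          (map (\<lambda>t. xs ! (t mod n)) [is ! k ..< (is @ [hd is + n]) ! Suc k]))"

definition bracket_functional ::
    "('a::complex_algebra_1 \<Rightarrow> complex) \<Rightarrow> 'a tensor_algebra \<Rightarrow> complex" where
  "bracket_functional \<phi> = tensor_functional (cyclic_boolean_moment \<phi>)"

end

theory Submission
  imports Defs
begin

text \<open>Expand \<open>[\<phi>]\<close> over the sets of cuts of the cyclic word. A Boolean cumulant vanishes as soon as
  two neighbouring arguments lie in different subalgebras. If the first and the last letter of a
  word do, then only the sets with a cut at the first letter contribute. These correspond to the
  interval partitions, so that they add up to the moment. Multilinearity and invariance under
  rotation of the sum over cuts make \<open>[\<phi>]\<close> a well-defined tracial functional, and reduce the claim
  on the spans to elementary tensors.\<close>

section \<open>Cuts of a cyclic word\<close>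

text \<open>The defining sums of \<phi> and [\<phi>] run over different objects: interval partitions
  read with \<open>nths\<close>, and increasing lists read modulo n. Encoding both by subsets of
  {..<n} gives them the same summand \<open>cumulant_product\<close>; only the families differ,
  subsets containing 0 against all nonempty ones. On words the claim becomes that the nonempty S
  without 0 contribute nothing, because the block covering the first letter then also covers the
  last.

  Letters inside a tensor need not alternate between subalgebras, so the vanishing of cumulants is
  derived from a condition at a single junction: the moments of all subwords straddling it factorize
  there. Merging runs of letters from one subalgebra yields this from Boolean independence.

  Multilinearity is no formality: \<open>bracket_functional\<close> is a definite description, which
  gives access to no value before \<open>cyclic_boolean_moment\<close> is known to be multilinear.
  Since the cumulants solve a recursion, this takes an induction on the length of words.\<close>

text \<open>A set \<open>S \<subseteq> {..<n}\<close> of cuts stands for its \<open>n\<close>-periodic extension, so that blocks that wrap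
  around the end of the word are ordinary intervals.\<close>

definition next_cut :: "nat \<Rightarrow> nat set \<Rightarrow> nat \<Rightarrow> nat" where
  "next_cut n S s = (LEAST t. s < t \<and> t mod n \<in> S)"

lemma next_cut:
  assumes "S \<noteq> {}" "S \<subseteq> {..<n}"
  shows less_next_cut: "s < next_cut n S s" and next_cut_mod: "next_cut n S s mod n \<in> S"
proof -
  obtain c where c: "c \<in> S" "c < n" using assms by auto
  \<comment> \<open>The witness for the next cut is c moved by s + 1 periods; as n is positive, that
    shift alone exceeds s.\<close>
  then have "Suc s * 1 \<le> Suc s * n" by (intro mult_le_mono2) simp
  then have "s < Suc s * n" by simp
  then have "s < c + Suc s * n \<and> (c + Suc s * n) mod n \<in> S"
    using c by (simp del: mult_Suc)
  then have "s < next_cut n S s \<and> next_cut n S s mod n \<in> S"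
    unfolding next_cut_def by (rule LeastI)
  then show "s < next_cut n S s" "next_cut n S s mod n \<in> S" by auto
qed

lemma next_cut_le: "s < t \<Longrightarrow> t mod n \<in> S \<Longrightarrow> next_cut n S s \<le> t"
  unfolding next_cut_def by (rule Least_le) simp

lemma next_cut_eqI:
  assumes "s < e" "e mod n \<in> S" "\<And>t. s < t \<Longrightarrow> t < e \<Longrightarrow> t mod n \<notin> S"
  shows "next_cut n S s = e"
  unfolding next_cut_def using assms by (intro Least_equality) (auto simp: not_less[symmetric])

text \<open>The cut s recurs one period later. So a block has at most n letters, and its positions
  are distinct modulo n.\<close>

lemma next_cut_le_period:
  assumes "s \<in> S" "S \<subseteq> {..<n}"
  shows "next_cut n S s \<le> s + n"
proof (rule next_cut_le)
  show "s < s + n" "(s + n) mod n \<in> S" using assms by auto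
qed

text \<open>As \<open>n mod n = 0\<close>, a cut at 0 is also a cut at n: no block wraps
  around.\<close>

lemma next_cut_le_length:
  assumes "0 \<in> S" "s < n"
  shows "next_cut n S s \<le> n"
  using assms by (intro next_cut_le) auto

lemma next_cut_add_period:
  assumes "S \<noteq> {}" "S \<subseteq> {..<n}"
  shows "next_cut n S (s + k * n) = next_cut n S s + k * n"
proof (rule next_cut_eqI)
  show "s + k * n < next_cut n S s + k * n" "(next_cut n S s + k * n) mod n \<in> S"
    using next_cut[OF assms] by auto
next
  fix t assume t: "s + k * n < t" "t < next_cut n S s + k * n"
  then obtain u where u: "t = u + k * n" by (metis add.commute le_add2 le_iff_add less_imp_le order_trans)
  show "t mod n \<notin> S"
    using next_cut_le[of s u n S] t u by auto
qed

text \<open>The block of t starts at the last cut not after t; c guarantees that there is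
  one.\<close>

lemma ex_cut_before:
  assumes "S \<noteq> {}" "S \<subseteq> {..<n}" "c \<le> t" "c mod n \<in> S"
  shows "\<exists>s. s \<le> t \<and> s mod n \<in> S \<and> t < next_cut n S s"
proof -
  define s where "s = Max {s. s \<le> t \<and> s mod n \<in> S}"
  have "s \<in> {s. s \<le> t \<and> s mod n \<in> S}" unfolding s_def using assms by (intro Max_in) auto
  moreover have "t < next_cut n S s"
  proof (rule ccontr)
    assume "\<not> t < next_cut n S s"
    then have "next_cut n S s \<in> {s. s \<le> t \<and> s mod n \<in> S}"
      using next_cut_mod[OF assms(1,2), of s] by simp
    then have "next_cut n S s \<le> s" unfolding s_def by (intro Max_ge) (auto simp: s_def)
    then show False using less_next_cut[OF assms(1,2), of s] by simp
  qed
  ultimately show ?thesis by auto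
qed

lemma cut_unique:
  assumes mem: "s mod n \<in> S" "s' mod n \<in> S"
    and t: "s \<le> t" "t < next_cut n S s" "s' \<le> t" "t < next_cut n S s'"
  shows "s = s'"
proof -
  have "\<not> s < s'" "\<not> s' < s"
    using next_cut_le[of s s' n S] next_cut_le[of s' s n S] mem t by auto
  then show ?thesis by simp
qed

text \<open>There may be no cut at or before p itself. At p + n the cuts of the first period serve,
  and the block found there is moved back by whole periods until its start lies in S.\<close>

lemma ex_cut_block:
  assumes S: "S \<noteq> {}" "S \<subseteq> {..<n}" and "p < n"
  shows "\<exists>s\<in>S. \<exists>t. s \<le> t \<and> t < next_cut n S s \<and> t mod n = p"
proof -
  obtain c where "c \<in> S" using S by auto
  then have "c \<le> p + n" "c mod n \<in> S" using S by auto
  from ex_cut_before[OF S this] obtain s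
    where s: "s \<le> p + n" "s mod n \<in> S" "p + n < next_cut n S s" by auto
  define k where "k = s div n"
  have sk: "s = s mod n + k * n" by (simp add: k_def)
  have "next_cut n S s = next_cut n S (s mod n) + k * n"
    using next_cut_add_period[OF S, of "s mod n" k] sk by simp
  then have "s mod n \<le> p + n - k * n \<and> p + n - k * n < next_cut n S (s mod n)" "k * n \<le> p + n"
    using s sk by linarith+
  moreover have "(p + n - k * n) mod n = p"
    using \<open>p < n\<close> \<open>k * n \<le> p + n\<close> by (metis add.commute le_add_diff_inverse2 mod_add_self2 mod_less mod_mult_self1)
  ultimately show ?thesis using s(2) by blast
qed

text \<open>Blocks are disjoint even modulo n: moving one block by the period multiple t' - t puts
  t' into two blocks of the periodic extension, whose starts then agree, and both starts lie below
  n.\<close>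

lemma cut_block_unique:
  assumes S: "S \<subseteq> {..<n}" and mem: "s \<in> S" "s' \<in> S"
    and t: "s \<le> t" "t < next_cut n S s" "s' \<le> t'" "t' < next_cut n S s'"
    and eq: "t mod n = t' mod n"
  shows "s = s'"
proof -
  have aux: "s = s'" if "s \<in> S" "s' \<in> S" "s \<le> t" "t < next_cut n S s" "s' \<le> t'" "t' < next_cut n S s'"
    "t \<le> t'" "t mod n = t' mod n" for s s' t t'
  proof -
    have "n dvd t' - t" using that by (metis mod_eq_dvd_iff_nat)
    then obtain k where k: "t' = t + k * n" using \<open>t \<le> t'\<close> by (metis dvd_def le_add_diff_inverse mult.commute)
    have ne: "S \<noteq> {}" using that by auto
    have "s + k * n = s'"
    proof (rule cut_unique)
      show "(s + k * n) mod n \<in> S" "s' mod n \<in> S" using that S by auto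
      show "s + k * n \<le> t'" "t' < next_cut n S (s + k * n)" "s' \<le> t'" "t' < next_cut n S s'"
        using that k next_cut_add_period[OF ne S] by auto
    qed
    moreover have "s < n" "s' < n" using that S by auto
    ultimately show ?thesis by (metis mod_less mod_mult_self1)
  qed
  show ?thesis
  proof (cases "t \<le> t'")
    case False
    then show ?thesis using aux[of s' s t' t] mem t eq by simp
  qed (use aux[of s s' t t'] mem t eq in simp)
qed

definition cyclic_word :: "'b list \<Rightarrow> nat set \<Rightarrow> nat \<Rightarrow> 'b list" where
  "cyclic_word xs S s = map (\<lambda>t. xs ! (t mod length xs)) [s..<next_cut (length xs) S s]"

text \<open>The common summand of both expansions: over S containing 0 it sums to the moment, over
  all nonempty S to [\<phi>].\<close>

definition cumulant_product ::
    "('a::complex_algebra_1 \<Rightarrow> complex) \<Rightarrow> 'a list \<Rightarrow> nat set \<Rightarrow> complex" where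
  "cumulant_product \<phi> xs S = (\<Prod>s\<in>S. boolean_cumulant \<phi> (cyclic_word xs S s))"

lemma cyclic_word_linear:
  assumes "0 \<in> S" "s < length xs"
  shows "cyclic_word xs S s = map ((!) xs) [s..<next_cut (length xs) S s]"
  using next_cut_le_length[OF assms] by (simp add: cyclic_word_def)

lemma nths_atLeastLessThan:
  assumes "e \<le> length xs"
  shows "nths xs {s..<e} = map ((!) xs) [s..<e]"
proof -
  have "filter (\<lambda>i. s \<le> i \<and> i < e) [0..<length xs] = [s..<e]"
    using assms by (intro sorted_distinct_set_unique) (auto simp: sorted_wrt_filter)
  moreover have "zip xs [0..<length xs] = map (\<lambda>i. (xs ! i, i)) [0..<length xs]"
    by (rule nth_equalityI) auto
  ultimately show ?thesis by (simp add: nths_def filter_map o_def)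
qed

lemma drop_append_take_conv_map:
  assumes "k \<le> length us" "l \<le> length vs"
  shows "drop k us @ take l vs = map ((!) (us @ vs)) [k..<length us + l]"
  using assms by (intro nth_equalityI) (auto simp: nth_append add.commute)

section \<open>Moments as sums over cuts\<close>

text \<open>The cuts of P are the least elements of its blocks. The block containing j + 1 must
  start there, since otherwise it would contain j as well and coincide with {i..j}. If j + 1 = n,
  the block of 0 takes this role, through the reduction modulo n.\<close>

lemma interval_partition_block_next_cut:
  assumes P: "P \<in> interval_partitions n" and B: "B \<in> P"
  shows "B = {Min B..<next_cut n (Min ` P) (Min B)}" "Min B \<in> B"
proof -
  have part: "partition_on {..<n} P" and int: "\<And>B. B \<in> P \<Longrightarrow> \<exists>i j. B = {i..j}"
    using P by (auto simp: interval_partitions_def)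
  have blk: "\<exists>i j. C = {i..j} \<and> i \<le> j \<and> j < n \<and> Min C = i" if C: "C \<in> P" for C
  proof -
    obtain i j where "C = {i..j}" using int[OF C] by auto
    moreover have "C \<noteq> {}" "C \<subseteq> {..<n}" using part C by (auto simp: partition_on_def)
    ultimately show ?thesis by (intro exI[of _ i] exI[of _ j]) (auto intro: Min_eqI)
  qed
  have disj: "C = D" if "C \<in> P" "D \<in> P" "x \<in> C" "x \<in> D" for C D x
    using part that unfolding partition_on_def disjoint_def by blast
  have cover: "\<exists>C\<in>P. x \<in> C" if "x < n" for x
    using part that by (auto simp: partition_on_def)
  obtain i j where ij: "B = {i..j}" "i \<le> j" "j < n" "Min B = i" using blk[OF B] by auto
  have "next_cut n (Min ` P) i = Suc j"
  proof (rule next_cut_eqI)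
    show "i < Suc j" using ij by simp
  next
    have "Suc j mod n < n" using ij by simp
    then obtain C where C: "C \<in> P" "Suc j mod n \<in> C" using cover by blast
    obtain i' j' where c: "C = {i'..j'}" "i' \<le> j'" "j' < n" "Min C = i'" using blk[OF C(1)] by auto
    have "i' = Suc j mod n"
    proof (cases "Suc j = n")
      case False
      then have Sj: "Suc j mod n = Suc j" using ij by simp
      show ?thesis
      proof (rule ccontr)
        assume "i' \<noteq> Suc j mod n"
        then have "i' \<le> j" using C c Sj by auto
        then have "j \<in> C" using C c Sj by auto
        then have "C = B" using disj[OF C(1) B] ij by auto
        then show False using C Sj ij by auto
      qed
    qed (use C c in auto)
    then show "Suc j mod n \<in> Min ` P" using C c by force
  next
    fix t assume t: "i < t" "t < Suc j"
    show "t mod n \<notin> Min ` P"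
    proof
      assume "t mod n \<in> Min ` P"
      then obtain C where C: "C \<in> P" "Min C = t" using t ij by auto
      obtain i' j' where "C = {i'..j'}" "i' \<le> j'" "Min C = i'" using blk[OF C(1)] by auto
      then have "t \<in> C" using C by auto
      then have "C = B" using disj[OF C(1) B, of t] t ij by auto
      then show False using C t ij by simp
    qed
  qed
  then show "B = {Min B..<next_cut n (Min ` P) (Min B)}" "Min B \<in> B" using ij by auto
qed

lemma cuts_interval_partition:
  assumes "n > 0" "S \<subseteq> {..<n}" "0 \<in> S"
  shows "(\<lambda>s. {s..<next_cut n S s}) ` S \<in> interval_partitions n"
proof -
  have ne: "S \<noteq> {}" using assms by auto
  have le: "next_cut n S s \<le> n" if "s \<in> S" for s
    using next_cut_le_length assms that by auto
  have lt: "s < next_cut n S s" for s using less_next_cut ne assms by blast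
  have "partition_on {..<n} ((\<lambda>s. {s..<next_cut n S s}) ` S)"
  proof (rule partition_onI)
    show "\<Union> ((\<lambda>s. {s..<next_cut n S s}) ` S) = {..<n}"
    proof
      show "\<Union> ((\<lambda>s. {s..<next_cut n S s}) ` S) \<subseteq> {..<n}"
        using le by (auto intro: less_le_trans)
      show "{..<n} \<subseteq> \<Union> ((\<lambda>s. {s..<next_cut n S s}) ` S)"
      proof
        fix t assume "t \<in> {..<n}"
        then obtain s where "s \<in> S" "s \<le> t" "t < next_cut n S s"
          using ex_cut_before[OF ne assms(2), of 0 t] assms(3) by auto
        then show "t \<in> \<Union> ((\<lambda>s. {s..<next_cut n S s}) ` S)" by auto
      qed
    qed
  next
    fix p q assume "p \<in> (\<lambda>s. {s..<next_cut n S s}) ` S" "q \<in> (\<lambda>s. {s..<next_cut n S s}) ` S" "p \<noteq> q"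
    then obtain s s' where "s \<in> S" "s' \<in> S" "p = {s..<next_cut n S s}" "q = {s'..<next_cut n S s'}"
      by auto
    with \<open>p \<noteq> q\<close> show "disjnt p q"
      using cut_block_unique[OF assms(2), of s s'] by (auto simp: disjnt_iff)
  next
    show "{} \<notin> (\<lambda>s. {s..<next_cut n S s}) ` S" using lt by (auto simp: not_le)
  qed
  moreover have "{s..<next_cut n S s} = {s..next_cut n S s - 1}" for s
    using lt[of s] by auto
  ultimately show ?thesis unfolding interval_partitions_def by blast
qed

lemma moment_sum_cuts:
  assumes "xs \<noteq> []"
  shows "\<phi> (prod_list xs) = (\<Sum>S | S \<subseteq> {..<length xs} \<and> 0 \<in> S. cumulant_product \<phi> xs S)"
proof -
  define n where "n = length xs"
  have n: "n > 0" using assms by (simp add: n_def)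
  let ?C = "{S. S \<subseteq> {..<n} \<and> 0 \<in> S}" and ?b = "\<lambda>S s. {s..<next_cut n S s}"
  have lt: "s < next_cut n S s" if "S \<in> ?C" for S s using less_next_cut that by blast
  have Min_b: "Min (?b S s) = s" if "S \<in> ?C" for S s
    using lt[OF that, of s] by (intro Min_eqI) auto
  have "\<phi> (prod_list xs) =
      (\<Sum>P \<in> interval_partitions n. \<Prod>B\<in>P. boolean_cumulant \<phi> (nths xs B))"
    using moment_boolean_cumulant[OF assms] by (simp add: n_def)
  also have "\<dots> = (\<Sum>S\<in>?C. cumulant_product \<phi> xs S)"
  proof (rule sum.reindex_bij_witness[where i = "\<lambda>S. ?b S ` S" and j = "\<lambda>P. Min ` P"])
    fix P assume P: "P \<in> interval_partitions n"
    note blk = interval_partition_block_next_cut[OF P]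
    show "(\<lambda>s. {s..<next_cut n (Min ` P) s}) ` Min ` P = P"
      using blk(1) by (force simp: image_image)
    have part: "partition_on {..<n} P" using P by (simp add: interval_partitions_def)
    then obtain B where B: "B \<in> P" "0 \<in> B" using n by (auto simp: partition_on_def)
    have "Min B = 0" using B blk(1)[OF B(1)] by (metis atLeastLessThan_iff le_zero_eq)
    moreover have "Min ` P \<subseteq> {..<n}" using part blk(2) by (auto simp: partition_on_def)
    ultimately show C: "Min ` P \<in> ?C" using B by force
    \<comment> \<open>A block is determined by its least element, so the product over the image has
      one factor per block.\<close>
    have "inj_on Min P" using blk(1) by (metis inj_onI)
    then have "cumulant_product \<phi> xs (Min ` P) =
        (\<Prod>B\<in>P. boolean_cumulant \<phi> (cyclic_word xs (Min ` P) (Min B)))"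
      by (simp add: cumulant_product_def prod.reindex)
    also have "\<dots> = (\<Prod>B\<in>P. boolean_cumulant \<phi> (nths xs B))"
    proof (rule prod.cong)
      fix B assume B: "B \<in> P"
      have "Min B < n" using C B by auto
      then have "cyclic_word xs (Min ` P) (Min B) = nths xs {Min B..<next_cut n (Min ` P) (Min B)}"
        using C next_cut_le_length[of "Min ` P" "Min B" n]
        by (subst nths_atLeastLessThan) (auto simp: n_def cyclic_word_linear)
      then show "boolean_cumulant \<phi> (cyclic_word xs (Min ` P) (Min B)) = boolean_cumulant \<phi> (nths xs B)"
        using blk(1)[OF B] by simp
    qed simp
    finally show "cumulant_product \<phi> xs (Min ` P) = (\<Prod>B\<in>P. boolean_cumulant \<phi> (nths xs B))" .
  next
    fix S assume S: "S \<in> ?C"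
    then show "Min ` ?b S ` S = S" by (simp add: image_image Min_b)
    show "?b S ` S \<in> interval_partitions n" using cuts_interval_partition n S by auto
  qed
  finally show ?thesis by (simp add: n_def)
qed

text \<open>The successor of an entry in the extended list is its next cut: strict sorting leaves no
  cut between neighbours, and after the last entry comes the first one a period later, which is the
  appended \<open>hd ys + n\<close>.\<close>

lemma cumulant_product_sorted_list:
  assumes ys: "sorted_wrt (<) ys" "ys \<noteq> []" "set ys \<subseteq> {..<length xs}"
  shows "(\<Prod>k<length ys. boolean_cumulant \<phi>
      (map (\<lambda>t. xs ! (t mod length xs)) [ys ! k ..< (ys @ [hd ys + length xs]) ! Suc k])) =
    cumulant_product \<phi> xs (set ys)"
proof -
  let ?n = "length xs"
  have mono: "ys ! i < ys ! j" if "i < j" "j < length ys" for i j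
    using ys(1) that by (simp add: sorted_wrt_iff_nth_less)
  have hd_le: "hd ys \<le> y" if "y \<in> set ys" for y
    using that mono ys(2) by (metis bot_nat_0.not_eq_extremum hd_conv_nth in_set_conv_nth less_imp_le order_refl)
  have eq: "next_cut ?n (set ys) (ys ! k) = (ys @ [hd ys + ?n]) ! Suc k" if k: "k < length ys" for k
  proof (cases "Suc k < length ys")
    case True
    have "next_cut ?n (set ys) (ys ! k) = ys ! Suc k"
    proof (rule next_cut_eqI)
      show "ys ! k < ys ! Suc k" using mono True by simp
      have "ys ! Suc k < ?n" using ys(3) True by (meson lessThan_iff nth_mem subsetD)
      then show "ys ! Suc k mod ?n \<in> set ys" using True by simp
      fix t assume t: "ys ! k < t" "t < ys ! Suc k"
      show "t mod ?n \<notin> set ys"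
      proof
        assume "t mod ?n \<in> set ys"
        then obtain i where i: "i < length ys" "ys ! i = t"
          using t \<open>ys ! Suc k < ?n\<close> by (auto simp: in_set_conv_nth)
        have "k < i" using i t k mono by (metis less_asym linorder_neqE_nat)
        moreover have "i < Suc k" using i t True mono by (metis less_asym linorder_neqE_nat)
        ultimately show False by simp
      qed
    qed
    then show ?thesis using True by (simp add: nth_append)
  next
    case False
    then have k: "k = length ys - 1" "Suc k = length ys" using k by auto
    have le: "y \<le> ys ! k" if "y \<in> set ys" for y
      using that mono k by (metis Suc_leI in_set_conv_nth lessI less_imp_le less_Suc_eq order_refl)
    have hd: "hd ys \<in> set ys" using ys(2) by simp
    then have "hd ys < ?n" using ys(3) by auto
    have "next_cut ?n (set ys) (ys ! k) = hd ys + ?n"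
    proof (rule next_cut_eqI)
      have "ys ! k < ?n" using ys(3) k by (metis lessI lessThan_iff nth_mem subsetD)
      then show "ys ! k < hd ys + ?n" by simp
      show "(hd ys + ?n) mod ?n \<in> set ys" using hd \<open>hd ys < ?n\<close> by simp
      fix t assume t: "ys ! k < t" "t < hd ys + ?n"
      show "t mod ?n \<notin> set ys"
      proof
        assume *: "t mod ?n \<in> set ys"
        show False
        proof (cases "t < ?n")
          case True then show False using * le[of t] t by simp
        next
          case False
          then have "t mod ?n = t - ?n" using t \<open>hd ys < ?n\<close> by (simp add: mod_if)
          then show False using hd_le * t False by fastforce
        qed
      qed
    qed
    then show ?thesis using k by (simp add: nth_append)
  qed
  have "distinct ys" using ys(1) by (simp add: strict_sorted_iff)
  then have "bij_betw ((!) ys) {..<length ys} (set ys)" by (simp add: bij_betw_nth)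
  then show ?thesis unfolding cumulant_product_def cyclic_word_def
    by (subst prod.reindex_bij_betw[symmetric]) (auto simp: eq intro!: prod.cong)
qed

text \<open>Strictly sorted lists of length l are the subsets of cardinality l, so the double sum is
  the sum over nonempty subsets grouped by cardinality.\<close>

lemma cyclic_boolean_moment_sum_cuts:
  assumes "xs \<noteq> []"
  shows "cyclic_boolean_moment \<phi> xs =
    (\<Sum>S | S \<subseteq> {..<length xs} \<and> S \<noteq> {}. cumulant_product \<phi> xs S)"
proof -
  let ?n = "length xs"
  let ?C = "{S. S \<subseteq> {..<?n} \<and> S \<noteq> {}}"
  let ?L = "\<lambda>l. {ys. length ys = l \<and> sorted_wrt (<) ys \<and> set ys \<subseteq> {..<?n}}"
  have "cyclic_boolean_moment \<phi> xs = (\<Sum>l = 1..?n. \<Sum>ys\<in>?L l.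
        \<Prod>k<l. boolean_cumulant \<phi>
          (map (\<lambda>t. xs ! (t mod ?n)) [ys ! k ..< (ys @ [hd ys + ?n]) ! Suc k]))"
    using assms by (simp add: cyclic_boolean_moment_def Let_def)
  also have "\<dots> = (\<Sum>l = 1..?n. \<Sum>S | S \<in> ?C \<and> card S = l. cumulant_product \<phi> xs S)"
  proof (rule sum.cong[OF refl])
    fix l assume l: "l \<in> {1..?n}"
    show "(\<Sum>ys\<in>?L l. \<Prod>k<l. boolean_cumulant \<phi>
          (map (\<lambda>t. xs ! (t mod ?n)) [ys ! k ..< (ys @ [hd ys + ?n]) ! Suc k])) =
        (\<Sum>S | S \<in> ?C \<and> card S = l. cumulant_product \<phi> xs S)"
    proof (rule sum.reindex_bij_witness[where i = sorted_list_of_set and j = set])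
      fix ys assume ys: "ys \<in> ?L l"
      then have "distinct ys" "sorted ys" by (auto simp: strict_sorted_iff)
      then show "sorted_list_of_set (set ys) = ys" by (simp add: sorted_list_of_set.idem_if_sorted_distinct)
      show "set ys \<in> {S \<in> ?C. card S = l}" using ys l \<open>distinct ys\<close> by (auto simp: distinct_card)
      show "cumulant_product \<phi> xs (set ys) = (\<Prod>k<l. boolean_cumulant \<phi>
          (map (\<lambda>t. xs ! (t mod ?n)) [ys ! k ..< (ys @ [hd ys + ?n]) ! Suc k]))"
        using cumulant_product_sorted_list[of ys xs \<phi>] ys l by (cases ys) auto
    next
      fix S assume S: "S \<in> {S \<in> ?C. card S = l}"
      then have "finite S" by (auto intro: finite_subset)
      then show "set (sorted_list_of_set S) = S" "sorted_list_of_set S \<in> ?L l" using S by auto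
    qed
  qed
  also have "\<dots> = (\<Sum>S\<in>?C. cumulant_product \<phi> xs S)"
  proof (rule sum.group)
    show "card ` ?C \<subseteq> {1..?n}"
    proof
      fix c assume "c \<in> card ` ?C"
      then obtain S where S: "S \<subseteq> {..<?n}" "S \<noteq> {}" "c = card S" by auto
      then show "c \<in> {1..?n}"
        using card_mono[OF _ S(1)] finite_subset[OF S(1)] by (auto simp: Suc_le_eq card_gt_0_iff)
    qed
  qed simp_all
  finally show ?thesis .
qed

section \<open>Multilinearity\<close>

interpretation scaleC: vector_space "scaleC :: complex \<Rightarrow> 'a::complex_algebra_1 \<Rightarrow> 'a"
  by (rule vector_space_scaleC)

text \<open>Additivity is the case r = s = 1, homogeneity the case s = 0. Updates at a position
  carry over to the blocks of a word more easily than splittings of the list.\<close>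

lemma multilinear_updateI:
  assumes "\<And>xs p x y r s. p < length xs \<Longrightarrow>
    f (xs[p := r *\<^sub>C x + s *\<^sub>C y]) = r * f (xs[p := x]) + s * f (xs[p := y])"
  shows "multilinear f"
  unfolding multilinear_def
proof (intro conjI allI)
  fix xs ys :: "'a list" and a b r
  show "f (xs @ [a + b] @ ys) = f (xs @ [a] @ ys) + f (xs @ [b] @ ys)"
    using assms[of "length xs" "xs @ [a] @ ys" 1 a 1 b] by simp
  show "f (xs @ [r *\<^sub>C a] @ ys) = r * f (xs @ [a] @ ys)"
    using assms[of "length xs" "xs @ [a] @ ys" r a 0 a] by simp
qed

lemma linear_functional_combination:
  "linear_functional f \<Longrightarrow> f (r *\<^sub>C x + s *\<^sub>C y) = r * f x + s * f y"
  by (simp add: linear_functional_iff)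

lemma linear_functional_zero: "linear_functional f \<Longrightarrow> f 0 = 0"
  using linear_functional_combination[of f 0 0 0 0] by simp

lemma linear_functional_mult_both:
  assumes "linear_functional f"
  shows "linear_functional (\<lambda>x. f (u * x * v))"
  using assms by (simp add: linear_functional_iff distrib_left distrib_right
    mult_scaleC_left mult_scaleC_right)

lemma linear_functional_prod_list_update:
  assumes "linear_functional f" "p < length xs"
  shows "f (prod_list (xs[p := r *\<^sub>C x + s *\<^sub>C y])) =
    r * f (prod_list (xs[p := x])) + s * f (prod_list (xs[p := y]))"
  using linear_functional_combination[OF linear_functional_mult_both[OF assms(1)]] assms(2)
  by (simp add: upd_conv_take_nth_drop mult.assoc[symmetric])

text \<open>Two positions of the block with the same residue are less than n apart, hence equal: the
  changed letter is read exactly once, at t.\<close>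

lemma cyclic_word_update_same:
  assumes S: "S \<subseteq> {..<length xs}" "s \<in> S" and t: "s \<le> t" "t < next_cut (length xs) S s"
  shows "cyclic_word (xs[t mod length xs := x]) S s = (cyclic_word xs S s)[t - s := x]"
proof (rule nth_equalityI)
  fix i assume i: "i < length (cyclic_word (xs[t mod length xs := x]) S s)"
  let ?n = "length xs"
  have n: "?n > 0" using S by auto
  have le: "next_cut ?n S s \<le> s + ?n" using next_cut_le_period S by auto
  have "(s + i) mod ?n = t mod ?n \<longleftrightarrow> i = t - s"
  proof
    assume eq: "(s + i) mod ?n = t mod ?n"
    have lt: "s + i < s + ?n" "t < s + ?n" using i le t by (auto simp: cyclic_word_def)
    have aux: "b \<le> a" if "a mod ?n = b mod ?n" "s \<le> a" "a < s + ?n" "s \<le> b" "b < s + ?n" for a b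
    proof (rule ccontr)
      assume *: "\<not> b \<le> a"
      then have "?n dvd b - a" using that by (metis linear mod_eq_dvd_iff_nat)
      then show False using * that by (auto dest: dvd_imp_le)
    qed
    show "i = t - s" using aux[OF eq] aux[OF eq[symmetric]] lt t by simp
  qed (use t in simp)
  then show "cyclic_word (xs[t mod ?n := x]) S s ! i = (cyclic_word xs S s)[t - s := x] ! i"
    using i n by (auto simp: cyclic_word_def nth_list_update)
qed (simp add: cyclic_word_def)

lemma cyclic_word_update_other:
  assumes "\<And>t. s \<le> t \<Longrightarrow> t < next_cut (length xs) S s \<Longrightarrow> t mod length xs \<noteq> p"
  shows "cyclic_word (xs[p := x]) S s = cyclic_word xs S s"
  using assms by (auto simp: cyclic_word_def intro!: nth_list_update_neq) metis

text \<open>The length bound makes this an induction hypothesis for the cumulants, whose recursion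
  only involves shorter lists.\<close>

definition multilinear_upto :: "nat \<Rightarrow> ('a::complex_algebra_1 list \<Rightarrow> complex) \<Rightarrow> bool" where
  "multilinear_upto m f \<longleftrightarrow> (\<forall>xs p x y r s. length xs \<le> m \<longrightarrow> p < length xs \<longrightarrow>
     f (xs[p := r *\<^sub>C x + s *\<^sub>C y]) = r * f (xs[p := x]) + s * f (xs[p := y]))"

text \<open>Exactly one block reads position p, so one factor depends on that letter and the others
  are constants. The bound m concerns the blocks, not the whole word.\<close>

lemma cumulant_product_update:
  assumes lin: "multilinear_upto m (boolean_cumulant \<phi>)"
    and S: "S \<noteq> {}" "S \<subseteq> {..<length xs}"
    and m: "\<And>s. s \<in> S \<Longrightarrow> next_cut (length xs) S s \<le> s + m" and p: "p < length xs"
  shows "cumulant_product \<phi> (xs[p := c *\<^sub>C x + d *\<^sub>C y]) S =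
    c * cumulant_product \<phi> (xs[p := x]) S + d * cumulant_product \<phi> (xs[p := y]) S"
proof -
  let ?n = "length xs"
  obtain s t where s: "s \<in> S" "s \<le> t" "t < next_cut ?n S s" "t mod ?n = p"
    using ex_cut_block[OF S p] by auto
  let ?w = "cyclic_word xs S s"
  have other: "cyclic_word (xs[p := z]) S s' = cyclic_word xs S s'" if "s' \<in> S - {s}" for z s'
  proof (rule cyclic_word_update_other)
    fix u assume "s' \<le> u" "u < next_cut ?n S s'"
    then show "u mod ?n \<noteq> p" using cut_block_unique[OF S(2), of s' s u t] that s by auto
  qed
  have same: "cyclic_word (xs[p := z]) S s = ?w[t - s := z]" for z
    using cyclic_word_update_same[OF S(2) s(1-3)] s(4) by simp
  have "finite S" using S finite_subset by blast
  then have split: "cumulant_product \<phi> (xs[p := z]) S = boolean_cumulant \<phi> (?w[t - s := z]) *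
      (\<Prod>s'\<in>S - {s}. boolean_cumulant \<phi> (cyclic_word xs S s'))" for z
    using s(1) by (simp add: cumulant_product_def prod.remove same other)
  have "length ?w \<le> m" "t - s < length ?w"
    using m[OF s(1)] s by (auto simp: cyclic_word_def)
  then have "boolean_cumulant \<phi> (?w[t - s := c *\<^sub>C x + d *\<^sub>C y]) =
      c * boolean_cumulant \<phi> (?w[t - s := x]) + d * boolean_cumulant \<phi> (?w[t - s := y])"
    using lin unfolding multilinear_upto_def by blast
  then show ?thesis by (simp add: split algebra_simps)
qed

lemma next_cut_singleton_0: "n > 0 \<Longrightarrow> next_cut n {0} 0 = n"
  by (rule next_cut_eqI) auto

lemma cumulant_product_singleton_0:
  assumes "xs \<noteq> []"
  shows "cumulant_product \<phi> xs {0} = boolean_cumulant \<phi> xs"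
  using assms by (simp add: cumulant_product_def cyclic_word_linear next_cut_singleton_0 map_nth)

text \<open>The cut set {0} encodes the one-block partition; this is the recursion for the cumulant
  rewritten with cuts.\<close>

lemma boolean_cumulant_sum_cuts:
  assumes "xs \<noteq> []"
  shows "boolean_cumulant \<phi> xs = \<phi> (prod_list xs) -
    (\<Sum>S\<in>{S. S \<subseteq> {..<length xs} \<and> 0 \<in> S} - {{0}}. cumulant_product \<phi> xs S)"
proof -
  have "{0} \<in> {S. S \<subseteq> {..<length xs} \<and> 0 \<in> S}" using assms by auto
  then show ?thesis
    using moment_sum_cuts[OF assms, of \<phi>]
    by (simp add: sum.remove[of _ "{0}"] cumulant_product_singleton_0 assms)
qed

text \<open>From s = 0 the next cut is at most the other cut c < n; from s > 0 it is at most n.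
  Either way the block is shorter than the word, which drives the inductions on length.\<close>

lemma next_cut_proper:
  assumes "S \<subseteq> {..<n}" "0 \<in> S" "S \<noteq> {0}" "s \<in> S"
  shows "next_cut n S s < s + n"
proof (cases "s = 0")
  case True
  obtain c where "c \<in> S" "c \<noteq> 0" using assms by auto
  then show ?thesis using next_cut_le[of s c n S] True assms by auto
next
  case False
  have "s < n" using assms by auto
  then show ?thesis using next_cut_le_length[of S s n] False assms by auto
qed

lemma multilinear_upto_boolean_cumulant:
  assumes "linear_functional \<phi>"
  shows "multilinear_upto m (boolean_cumulant \<phi>)"
proof (induction m)
  case 0
  show ?case by (simp add: multilinear_upto_def)
next
  case (Suc m)
  show ?case unfolding multilinear_upto_def
  proof (intro allI impI)
    fix xs :: "'a list" and p x y c d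
    assume len: "length xs \<le> Suc m" and p: "p < length xs"
    let ?C = "{S. S \<subseteq> {..<length xs} \<and> 0 \<in> S} - {{0}}"
    have ne: "xs[p := z] \<noteq> []" for z using p by auto
    have "cumulant_product \<phi> (xs[p := c *\<^sub>C x + d *\<^sub>C y]) S =
      c * cumulant_product \<phi> (xs[p := x]) S + d * cumulant_product \<phi> (xs[p := y]) S" if "S \<in> ?C" for S
    proof (rule cumulant_product_update[OF Suc.IH _ _ _ p])
      show "S \<noteq> {}" "S \<subseteq> {..<length xs}" using that by auto
      show "next_cut (length xs) S s \<le> s + m" if "s \<in> S" for s
        using next_cut_proper[of S "length xs" s] len that \<open>S \<in> ?C\<close> by auto
    qed
    then show "boolean_cumulant \<phi> (xs[p := c *\<^sub>C x + d *\<^sub>C y]) =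
        c * boolean_cumulant \<phi> (xs[p := x]) + d * boolean_cumulant \<phi> (xs[p := y])"
      by (simp add: boolean_cumulant_sum_cuts[OF ne] linear_functional_prod_list_update[OF assms p]
        sum.distrib sum_distrib_left[symmetric] algebra_simps)
  qed
qed

lemma multilinear_cyclic_boolean_moment:
  assumes "linear_functional \<phi>"
  shows "multilinear (cyclic_boolean_moment \<phi>)"
proof (rule multilinear_updateI)
  fix xs :: "'a list" and p x y c d
  assume p: "p < length xs"
  have ne: "xs[p := z] \<noteq> []" for z using p by auto
  have "cumulant_product \<phi> (xs[p := c *\<^sub>C x + d *\<^sub>C y]) S =
      c * cumulant_product \<phi> (xs[p := x]) S + d * cumulant_product \<phi> (xs[p := y]) S"
    if "S \<subseteq> {..<length xs}" "S \<noteq> {}" for S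
    using that next_cut_le_period
    by (intro cumulant_product_update[OF multilinear_upto_boolean_cumulant[OF assms] _ _ _ p]) auto
  then show "cyclic_boolean_moment \<phi> (xs[p := c *\<^sub>C x + d *\<^sub>C y]) =
      c * cyclic_boolean_moment \<phi> (xs[p := x]) + d * cyclic_boolean_moment \<phi> (xs[p := y])"
    by (simp add: cyclic_boolean_moment_sum_cuts[OF ne] sum.distrib sum_distrib_left[symmetric])
qed

section \<open>Traciality\<close>

text \<open>Position t of the rotated word is position t + 1 of the original, so cuts are pulled
  back along s \<mapsto> s + 1 modulo n.\<close>

lemma next_cut_rotate:
  assumes "S \<noteq> {}" "S \<subseteq> {..<n}"
  shows "Suc (next_cut n {s \<in> {..<n}. Suc s mod n \<in> S} s) = next_cut n S (Suc s)"
proof -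
  let ?e = "next_cut n S (Suc s)"
  have n: "n > 0" using assms by auto
  have shift: "t mod n \<in> {s \<in> {..<n}. Suc s mod n \<in> S} \<longleftrightarrow> Suc t mod n \<in> S" for t
    using n by (simp add: mod_Suc_eq)
  have e: "Suc s < ?e" "?e mod n \<in> S" using next_cut[OF assms] by auto
  have "next_cut n {s \<in> {..<n}. Suc s mod n \<in> S} s = ?e - 1"
  proof (rule next_cut_eqI, unfold shift)
    show "s < ?e - 1" "Suc (?e - 1) mod n \<in> S" using e by auto
    fix t assume "s < t" "t < ?e - 1"
    then show "Suc t mod n \<notin> S" using next_cut_le[of "Suc s" "Suc t" n S] by auto
  qed
  then show ?thesis using e by simp
qed

lemma cyclic_word_rotate1:
  assumes "S \<noteq> {}" "S \<subseteq> {..<length xs}" "s < length xs"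
  shows "cyclic_word (rotate1 xs) {s \<in> {..<length xs}. Suc s mod length xs \<in> S} s =
    cyclic_word xs S (Suc s mod length xs)"
proof -
  let ?n = "length xs"
  have n: "?n > 0" using assms by auto
  have "cyclic_word (rotate1 xs) {s \<in> {..<?n}. Suc s mod ?n \<in> S} s =
      map (\<lambda>t. xs ! (Suc t mod ?n)) [s..<next_cut ?n {s \<in> {..<?n}. Suc s mod ?n \<in> S} s]"
    using n by (auto simp: cyclic_word_def nth_rotate1 mod_Suc_eq)
  also have "\<dots> = map (\<lambda>t. xs ! (t mod ?n))
      (map Suc [s..<next_cut ?n {s \<in> {..<?n}. Suc s mod ?n \<in> S} s])"
    by simp
  also have "\<dots> = cyclic_word xs S (Suc s)"
    by (simp only: map_Suc_upt next_cut_rotate[OF assms(1,2)] cyclic_word_def)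
  \<comment> \<open>Only s = n - 1 needs an argument: its successor n becomes 0, and periodicity
    gives the same block a period earlier.\<close>
  also have "\<dots> = cyclic_word xs S (Suc s mod ?n)"
  proof (cases "Suc s = ?n")
    case True
    have "map (\<lambda>t. xs ! (t mod ?n)) [0 + ?n..<k + ?n] = map (\<lambda>t. xs ! (t mod ?n)) [0..<k]" for k
      by (rule nth_equalityI) auto
    then show ?thesis
      using True next_cut_add_period[OF assms(1,2), of 0 1] by (simp add: cyclic_word_def)
  next
    case False
    then show ?thesis using assms by simp
  qed
  finally show ?thesis .
qed

lemma bij_betw_Suc_mod: "bij_betw (\<lambda>s. Suc s mod n) {..<n} {..<n}"
proof (rule bij_betw_imageI)
  show inj: "inj_on (\<lambda>s. Suc s mod n) {..<n}"
    by (auto simp: inj_on_def mod_Suc split: if_splits)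
  show "(\<lambda>s. Suc s mod n) ` {..<n} = {..<n}"
    by (rule endo_inj_surj) (use inj in auto)
qed

text \<open>Rotation permutes the family of all nonempty cut sets and preserves the
  summands.\<close>

lemma cyclic_boolean_moment_rotate1:
  "cyclic_boolean_moment \<phi> (rotate1 xs) = cyclic_boolean_moment \<phi> xs"
proof (cases "xs = []")
  case False
  let ?n = "length xs" and ?f = "\<lambda>s. Suc s mod length xs"
  let ?r = "\<lambda>S. {s \<in> {..<?n}. ?f s \<in> S}"
  have inj: "inj_on ?f {..<?n}" and surj: "?f ` {..<?n} = {..<?n}"
    using bij_betw_Suc_mod[of ?n] by (auto simp: bij_betw_def)
  have img: "?f ` ?r S = S" if "S \<subseteq> {..<?n}" for S
    using that surj by auto
  have vim: "?r (?f ` S) = S" if "S \<subseteq> {..<?n}" for S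
    using that inj by (auto dest: inj_onD)
  have "(\<Sum>S | S \<subseteq> {..<?n} \<and> S \<noteq> {}. cumulant_product \<phi> (rotate1 xs) S) =
      (\<Sum>S | S \<subseteq> {..<?n} \<and> S \<noteq> {}. cumulant_product \<phi> xs S)"
  proof (rule sum.reindex_bij_witness[where i = ?r and j = "\<lambda>S. ?f ` S"])
    fix S assume S: "S \<in> {S. S \<subseteq> {..<?n} \<and> S \<noteq> {}}"
    then show "?f ` S \<in> {S. S \<subseteq> {..<?n} \<and> S \<noteq> {}}" using surj by auto
    show "?r (?f ` S) = S" "?f ` ?r S = S" using vim img S by auto
    show "?r S \<in> {S. S \<subseteq> {..<?n} \<and> S \<noteq> {}}" using img[of S] S by auto
    have "cumulant_product \<phi> xs (?f ` S) =
        (\<Prod>s\<in>S. boolean_cumulant \<phi> (cyclic_word xs (?f ` S) (?f s)))"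
      using inj_on_subset[OF inj] S by (simp add: cumulant_product_def prod.reindex)
    also have "\<dots> = cumulant_product \<phi> (rotate1 xs) S"
      unfolding cumulant_product_def
    proof (rule prod.cong[OF refl])
      fix s assume "s \<in> S"
      moreover from this have "?f ` S \<noteq> {}" "?f ` S \<subseteq> {..<?n}" "s < ?n" "?r (?f ` S) = S"
        using S surj vim by blast+
      ultimately show "boolean_cumulant \<phi> (cyclic_word xs (?f ` S) (?f s)) =
          boolean_cumulant \<phi> (cyclic_word (rotate1 xs) S s)"
        using cyclic_word_rotate1[of "?f ` S" xs s] by simp
    qed
    finally show "cumulant_product \<phi> xs (?f ` S) = cumulant_product \<phi> (rotate1 xs) S" .
  qed
  then show ?thesis using False by (simp add: cyclic_boolean_moment_sum_cuts)
qed simp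

lemma cyclic_boolean_moment_append_commute:
  "cyclic_boolean_moment \<phi> (xs @ ys) = cyclic_boolean_moment \<phi> (ys @ xs)"
proof -
  have "cyclic_boolean_moment \<phi> (rotate k zs) = cyclic_boolean_moment \<phi> zs" for k zs
    by (induction k) (simp_all add: rotate_def cyclic_boolean_moment_rotate1)
  then show ?thesis by (metis rotate_append)
qed

lemma tracial_bracket_functional:
  assumes "linear_functional \<phi>"
  shows "tracial (bracket_functional \<phi>)"
proof -
  note mult = multilinear_cyclic_boolean_moment[OF assms]
  have lin: "linear_functional (bracket_functional \<phi>)"
    and val: "bracket_functional \<phi> (tensor xs) = cyclic_boolean_moment \<phi> xs" for xs
    unfolding bracket_functional_def using tensor_functional[OF mult] by auto
  have comm: "bracket_functional \<phi> (tensor xs * tensor ys) = bracket_functional \<phi> (tensor ys * tensor xs)" for xs ys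
    by (simp add: tensor_append[symmetric] val cyclic_boolean_moment_append_commute)
  have tens: "bracket_functional \<phi> (tensor xs * u) = bracket_functional \<phi> (u * tensor xs)" for xs u
    by (induction u rule: tensor_algebra_induct)
      (use lin comm in \<open>simp_all add: linear_functional_zero distrib_left distrib_right
        mult_scaleC_left mult_scaleC_right linear_functional_iff\<close>)
  have "bracket_functional \<phi> (t * u) = bracket_functional \<phi> (u * t)" for t u
    by (induction t rule: tensor_algebra_induct)
      (use lin tens in \<open>simp_all add: linear_functional_zero distrib_left distrib_right
        mult_scaleC_left mult_scaleC_right linear_functional_iff\<close>)
  then show ?thesis by (simp add: tracial_def)
qed

section \<open>Vanishing of mixed Boolean cumulants\<close>

text \<open>The left word's wrap-around cut at p becomes the genuine cut p + 0 coming from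
  \<open>S\<^sub>2\<close>; the right word's wrap-around cut becomes p + q, which is 0 modulo the
  total length and comes from \<open>S\<^sub>1\<close>.\<close>

lemma next_cut_append:
  assumes S: "S\<^sub>1 \<subseteq> {..<p}" "0 \<in> S\<^sub>1" "S\<^sub>2 \<subseteq> {..<q}" "0 \<in> S\<^sub>2"
  shows "s < p \<Longrightarrow> next_cut (p + q) (S\<^sub>1 \<union> (+) p ` S\<^sub>2) s = next_cut p S\<^sub>1 s"
    and "s < q \<Longrightarrow> next_cut (p + q) (S\<^sub>1 \<union> (+) p ` S\<^sub>2) (p + s) = p + next_cut q S\<^sub>2 s"
proof -
  assume s: "s < p"
  have lt: "s < next_cut p S\<^sub>1 s" and mem: "next_cut p S\<^sub>1 s mod p \<in> S\<^sub>1"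
    using next_cut[of S\<^sub>1 p s] S by auto
  have le: "next_cut p S\<^sub>1 s \<le> p" using next_cut_le_length S s by auto
  show "next_cut (p + q) (S\<^sub>1 \<union> (+) p ` S\<^sub>2) s = next_cut p S\<^sub>1 s"
  proof (rule next_cut_eqI)
    show "next_cut p S\<^sub>1 s mod (p + q) \<in> S\<^sub>1 \<union> (+) p ` S\<^sub>2"
      using le mem S by (cases "next_cut p S\<^sub>1 s = p") auto
    show "t mod (p + q) \<notin> S\<^sub>1 \<union> (+) p ` S\<^sub>2" if "s < t" "t < next_cut p S\<^sub>1 s" for t
      using next_cut_le[of s t p S\<^sub>1] that le by auto
  qed (rule lt)
next
  assume s: "s < q"
  have lt: "s < next_cut q S\<^sub>2 s" and mem: "next_cut q S\<^sub>2 s mod q \<in> S\<^sub>2"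
    using next_cut[of S\<^sub>2 q s] S by auto
  have le: "next_cut q S\<^sub>2 s \<le> q" using next_cut_le_length S s by auto
  show "next_cut (p + q) (S\<^sub>1 \<union> (+) p ` S\<^sub>2) (p + s) = p + next_cut q S\<^sub>2 s"
  proof (rule next_cut_eqI)
    show "(p + next_cut q S\<^sub>2 s) mod (p + q) \<in> S\<^sub>1 \<union> (+) p ` S\<^sub>2"
      using le mem S by (cases "next_cut q S\<^sub>2 s = q") auto
    show "t mod (p + q) \<notin> S\<^sub>1 \<union> (+) p ` S\<^sub>2" if "p + s < t" "t < p + next_cut q S\<^sub>2 s" for t
      using next_cut_le[of s "t - p" q S\<^sub>2] that le S by auto
  qed (use lt in simp)
qed

lemma cumulant_product_append:
  assumes S: "S\<^sub>1 \<subseteq> {..<length us}" "0 \<in> S\<^sub>1" "S\<^sub>2 \<subseteq> {..<length vs}" "0 \<in> S\<^sub>2"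
  shows "cumulant_product \<phi> (us @ vs) (S\<^sub>1 \<union> (+) (length us) ` S\<^sub>2) =
    cumulant_product \<phi> us S\<^sub>1 * cumulant_product \<phi> vs S\<^sub>2"
proof -
  let ?p = "length us" and ?q = "length vs"
  let ?S = "S\<^sub>1 \<union> (+) ?p ` S\<^sub>2"
  have fin: "finite S\<^sub>1" "finite S\<^sub>2" using S finite_subset by blast+
  have disj: "S\<^sub>1 \<inter> (+) ?p ` S\<^sub>2 = {}" using S by auto
  have 1: "cyclic_word (us @ vs) ?S s = cyclic_word us S\<^sub>1 s" if "s \<in> S\<^sub>1" for s
  proof -
    have s: "s < ?p" using that S by auto
    have le: "next_cut ?p S\<^sub>1 s \<le> ?p" using next_cut_le_length S s by auto
    show ?thesis
      using s le S next_cut_append(1)[OF S s] by (subst (1 2) cyclic_word_linear) (auto simp: nth_append)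
  qed
  have 2: "cyclic_word (us @ vs) ?S (?p + s) = cyclic_word vs S\<^sub>2 s" if "s \<in> S\<^sub>2" for s
  proof -
    have s: "s < ?q" using that S by auto
    then show ?thesis
      using S next_cut_append(2)[OF S s]
      by (subst (1 2) cyclic_word_linear) (auto simp: nth_append intro!: nth_equalityI)
  qed
  show ?thesis
    unfolding cumulant_product_def using fin disj
    by (simp add: prod.union_disjoint prod.reindex 1 2)
qed

text \<open>With a cut at the junction, the cuts in the two halves are chosen independently, so the
  sum factors into two moment expansions.\<close>

lemma sum_cumulant_product_append:
  "(\<Sum>S | S \<subseteq> {..<length us + length vs} \<and> 0 \<in> S \<and> length us \<in> S. cumulant_product \<phi> (us @ vs) S) =
   \<phi> (prod_list us) * \<phi> (prod_list vs)"
  if "us \<noteq> []" "vs \<noteq> []"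
proof -
  let ?p = "length us" and ?q = "length vs"
  let ?C = "\<lambda>n. {S. S \<subseteq> {..<n} \<and> (0::nat) \<in> S}"
  have "\<phi> (prod_list us) * \<phi> (prod_list vs) =
      (\<Sum>(S\<^sub>1, S\<^sub>2) \<in> ?C ?p \<times> ?C ?q. cumulant_product \<phi> us S\<^sub>1 * cumulant_product \<phi> vs S\<^sub>2)"
    by (simp add: moment_sum_cuts that sum_product sum.cartesian_product)
  also have "\<dots> = (\<Sum>S | S \<subseteq> {..<?p + ?q} \<and> 0 \<in> S \<and> ?p \<in> S. cumulant_product \<phi> (us @ vs) S)"
  proof (rule sum.reindex_bij_witness[where j = "\<lambda>(S\<^sub>1, S\<^sub>2). S\<^sub>1 \<union> (+) ?p ` S\<^sub>2"
        and i = "\<lambda>S. (S \<inter> {..<?p}, {t. ?p + t \<in> S})"])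
    fix T assume T: "T \<in> ?C ?p \<times> ?C ?q"
    obtain S\<^sub>1 S\<^sub>2 where [simp]: "T = (S\<^sub>1, S\<^sub>2)" by fastforce
    show "(case T of (S\<^sub>1, S\<^sub>2) \<Rightarrow> S\<^sub>1 \<union> (+) ?p ` S\<^sub>2) \<in> {S. S \<subseteq> {..<?p + ?q} \<and> 0 \<in> S \<and> ?p \<in> S}"
      using T by auto
    show "((case T of (S\<^sub>1, S\<^sub>2) \<Rightarrow> S\<^sub>1 \<union> (+) ?p ` S\<^sub>2) \<inter> {..<?p},
        {t. ?p + t \<in> (case T of (S\<^sub>1, S\<^sub>2) \<Rightarrow> S\<^sub>1 \<union> (+) ?p ` S\<^sub>2)}) = T"
      using T by auto
    show "cumulant_product \<phi> (us @ vs) (case T of (S\<^sub>1, S\<^sub>2) \<Rightarrow> S\<^sub>1 \<union> (+) ?p ` S\<^sub>2) =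
        (case T of (S\<^sub>1, S\<^sub>2) \<Rightarrow> cumulant_product \<phi> us S\<^sub>1 * cumulant_product \<phi> vs S\<^sub>2)"
      using T by (simp add: cumulant_product_append)
  next
    fix S assume S: "S \<in> {S. S \<subseteq> {..<?p + ?q} \<and> 0 \<in> S \<and> ?p \<in> S}"
    have "s \<in> S \<inter> {..<?p} \<union> (+) ?p ` {t. ?p + t \<in> S}" if "s \<in> S" for s
    proof (cases "s < ?p")
      case False
      then have "s = ?p + (s - ?p)" by simp
      then show ?thesis using that by (metis (mono_tags) UnI2 image_eqI mem_Collect_eq)
    qed (use that in simp)
    then show "(case (S \<inter> {..<?p}, {t. ?p + t \<in> S}) of (S\<^sub>1, S\<^sub>2) \<Rightarrow> S\<^sub>1 \<union> (+) ?p ` S\<^sub>2) = S"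
      by auto
    show "(S \<inter> {..<?p}, {t. ?p + t \<in> S}) \<in> ?C ?p \<times> ?C ?q"
      using S \<open>us \<noteq> []\<close> by auto
  qed
  finally show ?thesis by simp
qed

text \<open>Among the sets of cuts that avoid the factorization point, all but the trivial one have a
  shorter mixed block, hence drop out by induction; the remaining ones add up to the product of
  the two moments.\<close>

lemma boolean_cumulant_append_eq_0:
  assumes "us \<noteq> []" "vs \<noteq> []"
    and "\<And>k l. k < length us \<Longrightarrow> 0 < l \<Longrightarrow> l \<le> length vs \<Longrightarrow>
      \<phi> (prod_list (drop k us @ take l vs)) = \<phi> (prod_list (drop k us)) * \<phi> (prod_list (take l vs))"
  shows "boolean_cumulant \<phi> (us @ vs) = 0"
  using assms
proof (induction "length us + length vs" arbitrary: us vs rule: less_induct)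
  case less
  let ?p = "length us" and ?n = "length us + length vs"
  define C where "C = {S. S \<subseteq> {..<?n} \<and> 0 \<in> S}"
  have pn: "0 < ?p" "?p < ?n" using less.prems by auto
  have zero: "cumulant_product \<phi> (us @ vs) S = 0" if "S \<in> C" "?p \<notin> S" "S \<noteq> {0}" for S
  proof -
    have S: "S \<noteq> {}" "S \<subseteq> {..<?n}" "0 \<in> S" using that by (auto simp: C_def)
    obtain s where s: "s \<le> ?p" "s mod ?n \<in> S" "?p < next_cut ?n S s"
      using ex_cut_before[OF S(1,2), of 0 ?p] S by auto
    have "s < ?n" using s pn by linarith
    then have "s \<in> S" using s by simp
    then have "s < ?p" using s that by (metis le_neq_implies_less)
    let ?e = "next_cut ?n S s"
    have e: "?e \<le> ?n" "?e < s + ?n"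
      using next_cut_le_length[OF S(3) \<open>s < ?n\<close>] next_cut_proper[OF S(2,3) that(3) \<open>s \<in> S\<close>] by auto
    have "cyclic_word (us @ vs) S s = drop s us @ take (?e - ?p) vs"
      using S s e \<open>s < ?n\<close> by (simp add: cyclic_word_linear drop_append_take_conv_map)
    moreover have "boolean_cumulant \<phi> (drop s us @ take (?e - ?p) vs) = 0"
    proof (rule less.hyps)
      show "length (drop s us) + length (take (?e - ?p) vs) < ?n" using s e \<open>s < ?p\<close> by auto
      show "drop s us \<noteq> []" "take (?e - ?p) vs \<noteq> []" using s e \<open>s < ?p\<close> less.prems by auto
      \<comment> \<open>Factorization was assumed for every nonempty suffix of \<open>us\<close> and
        prefix of \<open>vs\<close> so that the hypothesis passes to this block.\<close>
      show "\<phi> (prod_list (drop k (drop s us) @ take l (take (?e - ?p) vs))) =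
          \<phi> (prod_list (drop k (drop s us))) * \<phi> (prod_list (take l (take (?e - ?p) vs)))"
        if "k < length (drop s us)" "0 < l" "l \<le> length (take (?e - ?p) vs)" for k l
        using less.prems(3)[of "k + s" l] that by (simp add: min_absorb1)
    qed
    moreover have "finite S" using S finite_subset by blast
    ultimately show ?thesis
      using \<open>s \<in> S\<close> unfolding cumulant_product_def by (metis prod_zero)
  qed
  have fin: "finite C" unfolding C_def by simp
  have "\<phi> (prod_list (us @ vs)) = (\<Sum>S\<in>C. cumulant_product \<phi> (us @ vs) S)"
    using moment_sum_cuts[of "us @ vs" \<phi>] less.prems by (simp add: C_def)
  also have "\<dots> = (\<Sum>S\<in>{S \<in> C. ?p \<in> S} \<union> {{0}}. cumulant_product \<phi> (us @ vs) S)"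
    using fin zero pn by (intro sum.mono_neutral_right) (auto simp: C_def)
  also have "\<dots> = (\<Sum>S\<in>{S \<in> C. ?p \<in> S}. cumulant_product \<phi> (us @ vs) S) + boolean_cumulant \<phi> (us @ vs)"
    using fin pn less.prems by (subst sum.union_disjoint) (auto simp: cumulant_product_singleton_0)
  also have "(\<Sum>S\<in>{S \<in> C. ?p \<in> S}. cumulant_product \<phi> (us @ vs) S) =
      \<phi> (prod_list us) * \<phi> (prod_list vs)"
    using sum_cumulant_product_append[OF less.prems(1,2), of \<phi>] by (simp add: C_def conj_assoc)
  \<comment> \<open>Factorization of the full word: the sum over cuts at the junction is already the
    whole moment, which leaves zero for the cumulant split off.\<close>
  also have "\<dots> = \<phi> (prod_list (us @ vs))"
    using less.prems(3)[of 0 "length vs"] less.prems(1,2) by simp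
  finally show ?case by simp
qed

text \<open>Without a cut at \<open>0\<close> there is a block that wraps around, whose cumulant is mixed; the sets
  of cuts containing \<open>0\<close> are those of the moment.\<close>

lemma cyclic_boolean_moment_eq_moment:
  assumes "xs \<noteq> []"
    and fac: "\<And>k l. 0 < l \<Longrightarrow> l \<le> k \<Longrightarrow> k < length xs \<Longrightarrow>
      \<phi> (prod_list (drop k xs @ take l xs)) = \<phi> (prod_list (drop k xs)) * \<phi> (prod_list (take l xs))"
  shows "cyclic_boolean_moment \<phi> xs = \<phi> (prod_list xs)"
proof -
  let ?n = "length xs"
  have zero: "cumulant_product \<phi> xs S = 0" if S: "S \<subseteq> {..<?n}" "S \<noteq> {}" "0 \<notin> S" for S
  proof -
    obtain s t where s: "s \<in> S" "s \<le> t" "t < next_cut ?n S s" "t mod ?n = 0"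
      using ex_cut_block[OF S(2,1), of 0] assms(1) by auto
    let ?e = "next_cut ?n S s"
    have "?e \<le> s + ?n" using next_cut_le_period s S by auto
    have "0 < s" "s < ?n" using s S by (auto intro: gr0I)
    \<comment> \<open>As s is positive, t is a positive multiple of n, so the block runs past the
      end of the word.\<close>
    have "?n \<le> t" using s \<open>0 < s\<close> by (intro dvd_imp_le) auto
    \<comment> \<open>Having at most n letters, the block stops before returning to s; its suffix
      and prefix do not overlap, which is the condition l \<le> k in \<open>fac\<close>.\<close>
    then have e: "?n < ?e" "?e - ?n \<le> s" using s \<open>?e \<le> s + ?n\<close> by auto
    have "cyclic_word xs S s = drop s xs @ take (?e - ?n) xs"
      using e \<open>s < ?n\<close>
      by (intro nth_equalityI) (auto simp: cyclic_word_def nth_append mod_if add.commute)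
    moreover have "boolean_cumulant \<phi> (drop s xs @ take (?e - ?n) xs) = 0"
    proof (rule boolean_cumulant_append_eq_0)
      show "drop s xs \<noteq> []" "take (?e - ?n) xs \<noteq> []" using e \<open>s < ?n\<close> by auto
      show "\<phi> (prod_list (drop k (drop s xs) @ take l (take (?e - ?n) xs))) =
          \<phi> (prod_list (drop k (drop s xs))) * \<phi> (prod_list (take l (take (?e - ?n) xs)))"
        if "k < length (drop s xs)" "0 < l" "l \<le> length (take (?e - ?n) xs)" for k l
        using fac[of l "k + s"] that e by (simp add: min_absorb1)
    qed
    moreover have "finite S" using S finite_subset by blast
    ultimately show ?thesis
      using s(1) unfolding cumulant_product_def by (metis prod_zero)
  qed
  have "cyclic_boolean_moment \<phi> xs = (\<Sum>S | S \<subseteq> {..<?n} \<and> 0 \<in> S. cumulant_product \<phi> xs S)"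
    unfolding cyclic_boolean_moment_sum_cuts[OF assms(1)]
    using zero by (intro sum.mono_neutral_right) auto
  then show ?thesis by (simp add: moment_sum_cuts[OF assms(1)])
qed

section \<open>Boolean independence of words\<close>

lemma prod_list_in_subalgebra:
  assumes "subalgebra B" "xs \<noteq> []" "set xs \<subseteq> B"
  shows "prod_list xs \<in> B"
  using assms(2,3) by (induction xs rule: list_nonempty_induct)
    (use assms(1) in \<open>auto simp: subalgebra_def\<close>)

text \<open>Independence restated for lists of letters coloured by their index, which can be
  concatenated and treated by induction.\<close>

lemma boolean_independent_prod_list:
  assumes ind: "boolean_independent \<phi> I A" and "ws \<noteq> []"
    and ws: "\<forall>(i, a)\<in>set ws. i \<in> I \<and> a \<in> A i" "distinct_adj (map fst ws)"
  shows "\<phi> (prod_list (map snd ws)) = (\<Prod>w\<leftarrow>ws. \<phi> (snd w))"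
proof -
  let ?n = "length ws"
  have lst: "map (\<lambda>k. f (ws ! k)) [0..<?n] = map f ws" for f :: "'b \<times> 'a \<Rightarrow> 'c"
    by (rule nth_equalityI) auto
  have "\<phi> (\<Prod>k\<leftarrow>[0..<?n]. snd (ws ! k)) = (\<Prod>k<?n. \<phi> (snd (ws ! k)))"
  proof -
    have "1 \<le> ?n" using \<open>ws \<noteq> []\<close> by (simp add: Suc_le_eq)
    moreover have "fst (ws ! k) \<in> I \<and> snd (ws ! k) \<in> A (fst (ws ! k))" if "k < ?n" for k
      using ws(1) nth_mem[OF that] by (auto simp: case_prod_beta)
    moreover have "fst (ws ! k) \<noteq> fst (ws ! Suc k)" if "Suc k < ?n" for k
      using ws(2) that by (auto simp: distinct_adj_conv_nth)
    ultimately show ?thesis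
      using ind unfolding boolean_independent_def by (elim conjE allE[where x = ?n]
        allE[where x = "\<lambda>k. snd (ws ! k)"] allE[where x = "\<lambda>k. fst (ws ! k)"]) auto
  qed
  also have "\<dots> = (\<Prod>k\<leftarrow>[0..<?n]. \<phi> (snd (ws ! k)))"
    by (simp add: prod.distinct_set_conv_list[symmetric] atLeast0LessThan)
  finally show ?thesis unfolding lst[of "\<lambda>w. \<phi> (snd w)"] lst[of snd] .
qed

text \<open>Multiplying neighbours of equal colour stays inside the subalgebra and ends in an
  alternating word. Keeping the outer colours makes the result compatible with
  concatenation.\<close>

lemma merge_coloured_list:
  assumes sub: "\<And>i. i \<in> I \<Longrightarrow> subalgebra (A i)" and "us \<noteq> []"
    and "\<forall>(i, a)\<in>set us. i \<in> I \<and> a \<in> A i"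
  shows "\<exists>ws. ws \<noteq> [] \<and> (\<forall>(i, a)\<in>set ws. i \<in> I \<and> a \<in> A i) \<and> distinct_adj (map fst ws) \<and>
    fst (hd ws) = fst (hd us) \<and> fst (last ws) = fst (last us) \<and>
    prod_list (map snd ws) = prod_list (map snd us)"
  using assms(2,3)
proof (induction us rule: list_nonempty_induct)
  case (single u)
  then show ?case by (intro exI[of _ "[u]"]) auto
next
  case (cons u us)
  obtain ws where ws: "ws \<noteq> []" "\<forall>(i, a)\<in>set ws. i \<in> I \<and> a \<in> A i" "distinct_adj (map fst ws)"
    "fst (last ws) = fst (last us)" "prod_list (map snd ws) = prod_list (map snd us)"
    using cons by auto
  obtain i a where u: "u = (i, a)" by fastforce
  obtain j b vs where vs: "ws = (j, b) # vs" using ws(1) by (cases ws) auto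
  have ia: "i \<in> I" "a \<in> A i" using cons.prems u by auto
  show ?case
  proof (cases "i = j")
    case True
    have "a * b \<in> A i" using sub[OF ia(1)] ia ws(2) vs True by (auto simp: subalgebra_def)
    then show ?thesis
      using ws ia u vs True cons.hyps
      by (intro exI[of _ "(i, a * b) # vs"])
        (auto simp: mult.assoc distinct_adj_Cons split: if_splits)
  next
    case False
    then show ?thesis
      using ws ia u vs cons.hyps
      by (intro exI[of _ "(i, a) # ws"]) (auto simp: distinct_adj_Cons)
  qed
qed

text \<open>Each half is merged separately. The colours at the junction still differ, so the joined
  word alternates, and independence applies to it and to both halves.\<close>

lemma boolean_independent_append:
  assumes ind: "boolean_independent \<phi> I A" and ne: "us \<noteq> []" "vs \<noteq> []"
    and mem: "\<forall>(i, a)\<in>set (us @ vs). i \<in> I \<and> a \<in> A i" and neq: "fst (last us) \<noteq> fst (hd vs)"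
  shows "\<phi> (prod_list (map snd (us @ vs))) = \<phi> (prod_list (map snd us)) * \<phi> (prod_list (map snd vs))"
proof -
  have sub: "\<And>i. i \<in> I \<Longrightarrow> subalgebra (A i)" using ind by (auto simp: boolean_independent_def)
  obtain us' where us': "us' \<noteq> []" "\<forall>(i, a)\<in>set us'. i \<in> I \<and> a \<in> A i" "distinct_adj (map fst us')"
    "fst (last us') = fst (last us)" "prod_list (map snd us') = prod_list (map snd us)"
    using merge_coloured_list[of I A us] sub ne(1) mem by auto
  obtain vs' where vs': "vs' \<noteq> []" "\<forall>(i, a)\<in>set vs'. i \<in> I \<and> a \<in> A i" "distinct_adj (map fst vs')"
    "fst (hd vs') = fst (hd vs)" "prod_list (map snd vs') = prod_list (map snd vs)"
    using merge_coloured_list[of I A vs] sub ne(2) mem by auto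
  have "distinct_adj (map fst (us' @ vs'))"
    using us' vs' neq by (auto simp: distinct_adj_append_iff last_map hd_map)
  then have "\<phi> (prod_list (map snd (us' @ vs'))) = (\<Prod>w\<leftarrow>us' @ vs'. \<phi> (snd w))"
    using us' vs' by (intro boolean_independent_prod_list[OF ind]) auto
  then show ?thesis
    using us' vs' boolean_independent_prod_list[OF ind, of us'] boolean_independent_prod_list[OF ind, of vs']
    by simp
qed

section \<open>Reduced tensor algebras\<close>

text \<open>Generators are replaced by elements of their spans one coordinate at a time; m counts
  the coordinates already released. D will be the difference of the two sides of an
  identity.\<close>

lemma vanish_on_spans:
  fixes D :: "(nat \<Rightarrow> 'b::complex_algebra_1) \<Rightarrow> complex"
  assumes lin: "\<And>a k. k < n \<Longrightarrow> linear_functional (\<lambda>x. D (a(k := x)))"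
    and gen: "\<And>a. (\<And>k. k < n \<Longrightarrow> a k \<in> G k) \<Longrightarrow> D a = 0"
    and mem: "\<And>k. k < n \<Longrightarrow> a k \<in> scaleC.span (G k)"
  shows "D a = 0"
proof -
  have "D a = 0" if "\<And>k. k < n \<Longrightarrow> k < m \<Longrightarrow> a k \<in> scaleC.span (G k)"
    "\<And>k. k < n \<Longrightarrow> \<not> k < m \<Longrightarrow> a k \<in> G k" for m a
    using that
  proof (induction m arbitrary: a)
    case 0
    then show ?case by (intro gen) auto
  next
    case (Suc m)
    show ?case
    proof (cases "m < n")
      case True
      \<comment> \<open>The zero set of D in coordinate m is a subspace that contains the
        generators, hence their span.\<close>
      let ?K = "{x. D (a(m := x)) = 0}"
      have "scaleC.subspace ?K"
        using lin[OF True, of a] linear_functional_zero[OF lin[OF True, of a]]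
        by (auto simp: scaleC.subspace_def linear_functional_iff)
      moreover have "G m \<subseteq> ?K"
      proof
        fix x assume "x \<in> G m"
        then have "D (a(m := x)) = 0"
          using Suc.prems by (intro Suc.IH) auto
        then show "x \<in> ?K" by simp
      qed
      ultimately have "scaleC.span (G m) \<subseteq> ?K" by (intro scaleC.span_minimal)
      then show ?thesis using Suc.prems(1)[OF True] by auto
    next
      case False
      then show ?thesis using Suc.prems by (intro Suc.IH) auto
    qed
  qed
  from this[where m = n] mem show ?thesis by blast
qed

lemma linear_functionalI:
  assumes "\<And>r s x y. f (r *\<^sub>C x + s *\<^sub>C y) = r * f x + s * f y"
  shows "linear_functional f"
  unfolding linear_functional_iff
proof (intro conjI allI)
  fix x y c
  show "f (x + y) = f x + f y" using assms[of 1 x 1 y] by simp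
  show "f (c *\<^sub>C x) = c * f x" using assms[of c x 0 x] by simp
qed

lemma linear_functional_diff:
  "linear_functional f \<Longrightarrow> linear_functional g \<Longrightarrow> linear_functional (\<lambda>x. f x - g x)"
  by (auto simp: linear_functional_iff algebra_simps)

lemma linear_functional_prod_list_coordinate:
  assumes "linear_functional F" "k < n"
  shows "linear_functional (\<lambda>x. F (\<Prod>i\<leftarrow>[0..<n]. (a(k := x)) i))"
proof -
  have "map (a(k := x)) [0..<n] = (map a [0..<n])[k := x]" for x
    using assms(2) by (intro nth_equalityI) (auto simp: nth_list_update)
  then show ?thesis
    using assms by (intro linear_functionalI) (simp only: linear_functional_prod_list_update length_map length_upt minus_nat.diff_0)
qed

lemma linear_functional_prod_coordinate:
  fixes n :: nat
  assumes "linear_functional F" "k < n"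
  shows "linear_functional (\<lambda>x. \<Prod>i<n. F ((a(k := x)) i))"
proof -
  have "(\<Prod>i<n. F ((a(k := x)) i)) = F x * (\<Prod>i\<in>{..<n} - {k}. F (a i))" for x
    using assms(2) by (subst prod.remove[of _ k]) (auto intro!: prod.cong)
  then show ?thesis
    using assms(1) by (simp add: linear_functional_iff algebra_simps)
qed

lemma subalgebra_reduced_tensor_algebra: "subalgebra (reduced_tensor_algebra B)"
proof -
  let ?G = "{tensor xs | xs. xs \<noteq> [] \<and> set xs \<subseteq> B}"
  let ?R = "reduced_tensor_algebra B"
  have R: "?R = scaleC.span ?G" by (simp add: reduced_tensor_algebra_def)
  have gen: "tensor xs * tensor ys \<in> ?R" if "xs \<noteq> []" "set xs \<subseteq> B" "ys \<noteq> []" "set ys \<subseteq> B" for xs ys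
    unfolding R using that by (intro scaleC.span_base) (auto simp: tensor_append[symmetric] intro!: exI[of _ "xs @ ys"])
  have 1: "tensor xs * u \<in> ?R" if "u \<in> ?R" "xs \<noteq> []" "set xs \<subseteq> B" for xs u
    using that(1) unfolding R
  proof (induction rule: scaleC.span_induct_alt)
    case (step c x y)
    then show ?case
      using gen that(2,3) unfolding R
      by (auto simp: distrib_left mult_scaleC_right intro!: scaleC.span_add scaleC.span_scale)
  qed (simp add: scaleC.span_zero)
  have "t * u \<in> ?R" if "t \<in> ?R" "u \<in> ?R" for t u
    using that(1) unfolding R
  proof (induction rule: scaleC.span_induct_alt)
    case (step c x y)
    then show ?case
      using 1 that(2) unfolding R
      by (auto simp: distrib_right mult_scaleC_left intro!: scaleC.span_add scaleC.span_scale)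
  qed (simp add: scaleC.span_zero)
  then show ?thesis by (auto simp: subalgebra_def R)
qed

lemma prod_list_tensor: "(\<Prod>k\<leftarrow>ks. tensor (w k)) = tensor (concat (map w ks))"
  by (induction ks) (simp_all add: tensor_Nil tensor_append)

lemma prod_list_concat: "prod_list (concat xss) = prod_list (map prod_list xss)"
  by (induction xss) simp_all

text \<open>The extension of \<phi> sees only the product of the letters, and the product of a
  nonempty word over \<open>A (j k)\<close> stays in \<open>A (j k)\<close>. On generators the claim
  is thus independence of the original subalgebras.\<close>

lemma boolean_independent_extended_functional:
  assumes lin: "linear_functional \<phi>" and ind: "boolean_independent \<phi> I A"
  shows "boolean_independent (extended_functional \<phi>) I (\<lambda>i. reduced_tensor_algebra (A i))"
  unfolding boolean_independent_def
proof (intro conjI ballI allI impI)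
  fix n and a :: "nat \<Rightarrow> 'a tensor_algebra" and j
  assume n: "1 \<le> n" and mem: "\<forall>k<n. j k \<in> I \<and> a k \<in> reduced_tensor_algebra (A (j k))"
    and adj: "\<forall>k. Suc k < n \<longrightarrow> j k \<noteq> j (Suc k)"
  let ?E = "extended_functional \<phi>" and ?G = "\<lambda>k. {tensor xs | xs. xs \<noteq> [] \<and> set xs \<subseteq> A (j k)}"
  let ?D = "\<lambda>a. ?E (\<Prod>k\<leftarrow>[0..<n]. a k) - (\<Prod>k<n. ?E (a k))"
  have "?D a = 0"
  proof (rule vanish_on_spans[where D = ?D and n = n and G = ?G])
    show "linear_functional (\<lambda>x. ?D (a(k := x)))" if "k < n" for a k
      using that linear_extended_functional[OF lin]
      by (intro linear_functional_diff linear_functional_prod_list_coordinate linear_functional_prod_coordinate)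
    show "a k \<in> scaleC.span (?G k)" if "k < n" for k
      using mem that by (simp add: reduced_tensor_algebra_def)
  next
    fix a assume "\<And>k. k < n \<Longrightarrow> a k \<in> ?G k"
    then have "\<forall>k. \<exists>xs. k < n \<longrightarrow> a k = tensor xs \<and> xs \<noteq> [] \<and> set xs \<subseteq> A (j k)" by blast
    then obtain w where w: "\<And>k. k < n \<Longrightarrow> a k = tensor (w k) \<and> w k \<noteq> [] \<and> set (w k) \<subseteq> A (j k)"
      by metis
    have "(\<Prod>k\<leftarrow>[0..<n]. a k) = (\<Prod>k\<leftarrow>[0..<n]. tensor (w k))"
      using w by (intro arg_cong[where f = prod_list] map_cong) auto
    then have "?E (\<Prod>k\<leftarrow>[0..<n]. a k) = \<phi> (\<Prod>k\<leftarrow>[0..<n]. prod_list (w k))"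
      by (simp add: prod_list_tensor extended_functional_tensor[OF lin] prod_list_concat o_def)
    also have "\<dots> = (\<Prod>k<n. \<phi> (prod_list (w k)))"
    proof -
      have "\<forall>k<n. j k \<in> I \<and> prod_list (w k) \<in> A (j k)"
        using mem w ind by (auto intro!: prod_list_in_subalgebra simp: boolean_independent_def)
      then show ?thesis using ind n adj unfolding boolean_independent_def by simp
    qed
    also have "\<dots> = (\<Prod>k<n. ?E (a k))"
      using w by (simp add: extended_functional_tensor[OF lin])
    finally show "?D a = 0" by simp
  qed
  then show "?E (\<Prod>k\<leftarrow>[0..<n]. a k) = (\<Prod>k<n. ?E (a k))" by simp
qed (rule subalgebra_reduced_tensor_algebra)

lemma cyclic_boolean_moment_concat:
  assumes ind: "boolean_independent \<phi> I A" and n: "0 < n"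
    and w: "\<And>k. k < n \<Longrightarrow> j k \<in> I \<and> w k \<noteq> [] \<and> set (w k) \<subseteq> A (j k)"
    and j: "j (n - 1) \<noteq> j 0"
  defines "W \<equiv> concat (map w [0..<n])"
  shows "cyclic_boolean_moment \<phi> W = \<phi> (prod_list W)"
proof -
  \<comment> \<open>A letter may lie in several of the subalgebras, so its index is carried
    along.\<close>
  define U where "U = concat (map (\<lambda>k. map (Pair (j k)) (w k)) [0..<n])"
  have WU: "W = map snd U" by (simp add: W_def U_def map_concat o_def)
  have mem: "\<forall>(i, a)\<in>set U. i \<in> I \<and> a \<in> A i" using w by (fastforce simp: U_def)
  have "U = map (Pair (j 0)) (w 0) @ concat (map (\<lambda>k. map (Pair (j k)) (w k)) [1..<n])"
    using n by (simp add: U_def upt_conv_Cons)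
  then have hd: "U \<noteq> []" "fst (hd U) = j 0" using w[OF n] by (auto simp: hd_map)
  have "[0..<n] = [0..<n - 1] @ [n - 1]" using n by (cases n) auto
  then have "U = concat (map (\<lambda>k. map (Pair (j k)) (w k)) [0..<n - 1]) @ map (Pair (j (n - 1))) (w (n - 1))"
    by (simp add: U_def)
  then have last: "fst (last U) = j (n - 1)" using w[of "n - 1"] n by (auto simp: last_map)
  show ?thesis
  proof (rule cyclic_boolean_moment_eq_moment)
    show "W \<noteq> []" using hd WU by simp
    fix k l assume kl: "0 < l" "l \<le> k" "k < length W"
    \<comment> \<open>Every nonempty suffix ends in the colour \<open>j (n - 1)\<close> and every
      nonempty prefix starts in \<open>j 0\<close>, so all these subwords factorize at the seam,
      wherever the cuts fall inside the tensors.\<close>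
    then have "fst (last (drop k U)) \<noteq> fst (hd (take l U))"
      using j hd last WU by simp
    moreover have "\<forall>(i, a)\<in>set (drop k U @ take l U). i \<in> I \<and> a \<in> A i"
      using mem by (auto dest: in_set_dropD in_set_takeD)
    ultimately show "\<phi> (prod_list (drop k W @ take l W)) =
        \<phi> (prod_list (drop k W)) * \<phi> (prod_list (take l W))"
      using boolean_independent_append[OF ind, of "drop k U" "take l U"] kl hd
      by (simp add: WU drop_map take_map)
  qed
qed

theorem corollary1p11:
  fixes \<phi> :: "'a::complex_algebra_1 \<Rightarrow> complex"
    and I :: "'i set"
    and A :: "'i \<Rightarrow> 'a set"
  assumes "linear_functional \<phi>"
    and "\<phi> 1 = 1"
    and "boolean_independent \<phi> I A"
  shows "cyclic_boolean_independent (extended_functional \<phi>) (bracket_functional \<phi>) I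
    (\<lambda>i. reduced_tensor_algebra (A i))"
  unfolding cyclic_boolean_independent_def
proof (intro conjI allI impI)
  note mult = multilinear_cyclic_boolean_moment[OF assms(1)]
  show lin: "linear_functional (bracket_functional \<phi>)"
    unfolding bracket_functional_def by (rule linear_tensor_functional[OF mult])
  show "tracial (bracket_functional \<phi>)" by (rule tracial_bracket_functional[OF assms(1)])
  show "boolean_independent (extended_functional \<phi>) I (\<lambda>i. reduced_tensor_algebra (A i))"
    by (rule boolean_independent_extended_functional[OF assms(1,3)])
  fix n and a :: "nat \<Rightarrow> 'a tensor_algebra" and j
  assume n: "2 \<le> n" and mem: "\<forall>k<n. j k \<in> I \<and> a k \<in> reduced_tensor_algebra (A (j k))"
    and j: "j (n - 1) \<noteq> j 0"
  let ?E = "extended_functional \<phi>" and ?B = "bracket_functional \<phi>"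
  let ?G = "\<lambda>k. {tensor xs | xs. xs \<noteq> [] \<and> set xs \<subseteq> A (j k)}"
  let ?D = "\<lambda>a. ?B (\<Prod>k\<leftarrow>[0..<n]. a k) - ?E (\<Prod>k\<leftarrow>[0..<n]. a k)"
  have "?D a = 0"
  proof (rule vanish_on_spans[where D = ?D and n = n and G = ?G])
    show "linear_functional (\<lambda>x. ?D (a(k := x)))" if "k < n" for a k
      using that lin linear_extended_functional[OF assms(1)]
      by (intro linear_functional_diff linear_functional_prod_list_coordinate)
    show "a k \<in> scaleC.span (?G k)" if "k < n" for k
      using mem that by (simp add: reduced_tensor_algebra_def)
  next
    fix a assume "\<And>k. k < n \<Longrightarrow> a k \<in> ?G k"
    then have "\<forall>k. \<exists>xs. k < n \<longrightarrow> a k = tensor xs \<and> xs \<noteq> [] \<and> set xs \<subseteq> A (j k)" by blast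
    then obtain w where w: "\<And>k. k < n \<Longrightarrow> a k = tensor (w k) \<and> w k \<noteq> [] \<and> set (w k) \<subseteq> A (j k)"
      by metis
    have "(\<Prod>k\<leftarrow>[0..<n]. a k) = (\<Prod>k\<leftarrow>[0..<n]. tensor (w k))"
      using w by (intro arg_cong[where f = prod_list] map_cong) auto
    moreover have "cyclic_boolean_moment \<phi> (concat (map w [0..<n])) =
        \<phi> (prod_list (concat (map w [0..<n])))"
      using n mem w j by (intro cyclic_boolean_moment_concat[OF assms(3), where j = j]) auto
    ultimately show "?D a = 0"
      by (simp add: prod_list_tensor extended_functional_tensor[OF assms(1)]
        bracket_functional_def tensor_functional_tensor[OF mult])
  qed
  then show "?B (\<Prod>k\<leftarrow>[0..<n]. a k) = ?E (\<Prod>k\<leftarrow>[0..<n]. a k)" by simp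
qed

end
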